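(* Let $\kappa$ be a singular strong limit cardinal of cofinality $\lambda>\omega$. Suppose there is a stationary set $S\subseteq\kappa$ such that $\square_\delta$ holds for all $\delta\in S$ and such that $\prod_{\delta\in S}\delta^+$ carries a good scale. Then there is a partial square sequence on $\kappa^+\cap\mathrm{cof}(>\lambda)$, the set of ordinals below $\kappa^+$ of cofinality greater than $\lambda$.
   Context: For a cardinal $\mu$, $\square_\mu$ asserts the existence of a sequence $\langle C_\alpha:\alpha\in\lim(\mu^+)\rangle$ such that each $C_\alpha$ is a club subset of $\alpha$ of order type $\le\mu$, and whenever $\beta$ is a limit point of $C_\alpha$ below $\alpha$, $C_\alpha\cap\beta=C_\beta$. If $\mu$ is a cardinal and $T\subseteq\lim(\mu^+)$ is stationary, a partial square sequence on $T$ is a sequence $\langle C_\alpha:\alpha\in T\rangle$ such that for all $\alpha\in T$: $C_\alpha$ is closed and unbounded in $\alpha$; $\mathrm{ot}(C_\alpha)\le\mu$; and if $\beta\in T$ and $\gamma$ is a limit point of both $C_\alpha$ and $C_\beta$, then $C_\alpha\cap\gamma=C_\beta\cap\gamma$ (here $\mu=\kappa$). For functions $f,g$ with domain $S$, $f<^*g$ means there is $j$ with $f(\delta)<g(\delta)$ for all $\delta\in S$, $\delta\ge j$. A scale on $\prod_{\delta\in S}\delta^+$ is a sequence $\langle f_\alpha:\alpha<\kappa^+\rangle$ of functions in the product with $f_\beta<^*f_\alpha$ for $\beta<\alpha$, cofinal in the product under $<^*$. A point $\alpha<\kappa^+$ is good if there are an unbounded $A\subseteq\alpha$ of order type $\mathrm{cf}(\alpha)$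 and $j$ such that $\langle f_\beta(\delta):\beta\in A\rangle$ is strictly increasing for all $\delta\in S$ with $\delta\ge j$; the scale is good if there is a club $D\subseteq\kappa^+$ all of whose elements of cofinality $>\mathrm{cf}(\kappa)$ are good points. *)

theory Defs
  imports Main "HOL-Library.FuncSet"
begin

unbundle cardinal_syntax

text \<open>Ordinals are the elements of an arbitrary type of class \<open>wellorder\<close>; the ordinal \<open>\<alpha>\<close> is identified
  with its set of predecessors \<open>{..<\<alpha>}\<close>. The type need not be closed under any ordinal operation, so a
  value given by \<open>LEAST\<close> below is meaningful only if a witness exists in the type.\<close>

definition ordrel :: "'a::wellorder set \<Rightarrow> 'a rel" where
  "ordrel A = {(x, y). x \<in> A \<and> y \<in> A \<and> x \<le> y}"

text \<open>A witness exists whenever \<open>A \<subseteq> {..<\<alpha>}\<close> for some \<open>\<alpha>\<close> (and then \<open>otp A \<le> \<alpha>\<close>).\<close>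

definition otp :: "'a::wellorder set \<Rightarrow> 'a" where
  "otp A = (LEAST \<beta>. ordrel A =o ordrel {..<\<beta>})"

definition is_cardinal :: "'a::wellorder \<Rightarrow> bool" where
  "is_cardinal \<kappa> \<longleftrightarrow> Card_order (ordrel {..<\<kappa>})"

definition succ_card :: "'a::wellorder \<Rightarrow> 'a" where
  "succ_card \<kappa> = (LEAST \<nu>. \<kappa> < \<nu> \<and> is_cardinal \<nu>)"

definition first_infinite :: "'a::wellorder" where
  "first_infinite = (LEAST \<alpha>. infinite {..<\<alpha>})"

text \<open>With \<open>\<xi> \<le> \<eta>\<close> rather than \<open>\<xi> < \<eta>\<close>, successor ordinals have cofinality 1; for limit
  \<open>\<alpha>\<close> both conditions agree.\<close>

definition unbounded_in :: "'a::wellorder set \<Rightarrow> 'a \<Rightarrow> bool" where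
  "unbounded_in A \<alpha> \<longleftrightarrow> A \<subseteq> {..<\<alpha>} \<and> (\<forall>\<xi><\<alpha>. \<exists>\<eta>\<in>A. \<xi> \<le> \<eta>)"

definition cof :: "'a::wellorder \<Rightarrow> 'a" where
  "cof \<alpha> = (LEAST \<beta>. \<exists>A. unbounded_in A \<alpha> \<and> otp A = \<beta>)"

text \<open>The first conjunct excludes \<open>\<gamma> = 0\<close>. Membership \<open>\<gamma> \<in> C\<close> is not required.\<close>

definition limit_point :: "'a::wellorder \<Rightarrow> 'a set \<Rightarrow> bool" where
  "limit_point \<gamma> C \<longleftrightarrow> {..<\<gamma>} \<noteq> {} \<and> (\<forall>\<xi><\<gamma>. \<exists>\<eta>\<in>C. \<xi> < \<eta> \<and> \<eta> < \<gamma>)"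

definition lim_below :: "'a::wellorder \<Rightarrow> 'a set" where
  "lim_below \<nu> = {\<alpha>. \<alpha> < \<nu> \<and> limit_point \<alpha> UNIV}"

definition club_in :: "'a::wellorder set \<Rightarrow> 'a \<Rightarrow> bool" where
  "club_in C \<alpha> \<longleftrightarrow> unbounded_in C \<alpha> \<and> (\<forall>\<gamma><\<alpha>. limit_point \<gamma> C \<longrightarrow> \<gamma> \<in> C)"

definition stationary_in :: "'a::wellorder set \<Rightarrow> 'a \<Rightarrow> bool" where
  "stationary_in S \<alpha> \<longleftrightarrow> S \<subseteq> {..<\<alpha>} \<and> (\<forall>C. club_in C \<alpha> \<longrightarrow> S \<inter> C \<noteq> {})"

definition singular_cardinal :: "'a::wellorder \<Rightarrow> bool" where
  "singular_cardinal \<kappa> \<longleftrightarrow> is_cardinal \<kappa> \<and> infinite {..<\<kappa>} \<and> cof \<kappa> < \<kappa>"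

definition strong_limit_cardinal :: "'a::wellorder \<Rightarrow> bool" where
  "strong_limit_cardinal \<kappa> \<longleftrightarrow>
     is_cardinal \<kappa> \<and> infinite {..<\<kappa>} \<and> (\<forall>\<mu><\<kappa>. |Pow {..<\<mu>}| <o |{..<\<kappa>}| )"

definition square :: "'a::wellorder \<Rightarrow> bool" where
  "square \<mu> \<longleftrightarrow> (\<exists>C :: 'a \<Rightarrow> 'a set. \<forall>\<alpha>\<in>lim_below (succ_card \<mu>).
     club_in (C \<alpha>) \<alpha> \<and> otp (C \<alpha>) \<le> \<mu> \<and>
     (\<forall>\<beta><\<alpha>. limit_point \<beta> (C \<alpha>) \<longrightarrow> C \<alpha> \<inter> {..<\<beta>} = C \<beta>))"

definition partial_square_seq :: "'a::wellorder \<Rightarrow> 'a set \<Rightarrow> ('a \<Rightarrow> 'a set) \<Rightarrow> bool" where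
  "partial_square_seq \<mu> T C \<longleftrightarrow>
     is_cardinal \<mu> \<and> T \<subseteq> lim_below (succ_card \<mu>) \<and> stationary_in T (succ_card \<mu>) \<and>
     (\<forall>\<alpha>\<in>T. club_in (C \<alpha>) \<alpha> \<and> otp (C \<alpha>) \<le> \<mu> \<and>
       (\<forall>\<beta>\<in>T. \<forall>\<gamma>. limit_point \<gamma> (C \<alpha>) \<and> limit_point \<gamma> (C \<beta>) \<longrightarrow>
          C \<alpha> \<inter> {..<\<gamma>} = C \<beta> \<inter> {..<\<gamma>}))"

definition succ_prod :: "'a::wellorder set \<Rightarrow> ('a \<Rightarrow> 'a) set" where
  "succ_prod S = (\<Pi>\<^sub>E \<delta>\<in>S. {..<succ_card \<delta>})"

text \<open>Here \<open>S \<subseteq> {..<\<kappa>}\<close>; the bound \<open>j < \<kappa>\<close> keeps the relation from being vacuously true.\<close>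

definition ev_less :: "'a::wellorder \<Rightarrow> 'a set \<Rightarrow> ('a \<Rightarrow> 'a) \<Rightarrow> ('a \<Rightarrow> 'a) \<Rightarrow> bool" where
  "ev_less \<kappa> S f g \<longleftrightarrow> (\<exists>j<\<kappa>. \<forall>\<delta>\<in>S. j \<le> \<delta> \<longrightarrow> f \<delta> < g \<delta>)"

definition scale :: "'a::wellorder \<Rightarrow> 'a set \<Rightarrow> ('a \<Rightarrow> 'a \<Rightarrow> 'a) \<Rightarrow> bool" where
  "scale \<kappa> S f \<longleftrightarrow>
     (\<forall>\<alpha><succ_card \<kappa>. f \<alpha> \<in> succ_prod S) \<and>
     (\<forall>\<alpha><succ_card \<kappa>. \<forall>\<beta><\<alpha>. ev_less \<kappa> S (f \<beta>) (f \<alpha>)) \<and>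
     (\<forall>g\<in>succ_prod S. \<exists>\<alpha><succ_card \<kappa>. ev_less \<kappa> S g (f \<alpha>))"

definition good_point :: "'a::wellorder \<Rightarrow> 'a set \<Rightarrow> ('a \<Rightarrow> 'a \<Rightarrow> 'a) \<Rightarrow> 'a \<Rightarrow> bool" where
  "good_point \<kappa> S f \<alpha> \<longleftrightarrow>
     (\<exists>A. unbounded_in A \<alpha> \<and> otp A = cof \<alpha> \<and>
       (\<exists>j<\<kappa>. \<forall>\<delta>\<in>S. j \<le> \<delta> \<longrightarrow> strict_mono_on A (\<lambda>\<beta>. f \<beta> \<delta>)))"

definition good_scale :: "'a::wellorder \<Rightarrow> 'a set \<Rightarrow> ('a \<Rightarrow> 'a \<Rightarrow> 'a) \<Rightarrow> bool" where
  "good_scale \<kappa> S f \<longleftrightarrow> scale \<kappa> S f \<and>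
     (\<exists>D. club_in D (succ_card \<kappa>) \<and> (\<forall>\<alpha>\<in>D. cof \<kappa> < cof \<alpha> \<longrightarrow> good_point \<kappa> S f \<alpha>))"

end

(* Work modulo the club filter on kappa, restricted to a set S' of limit points of a cofinal subset of
   kappa of order type lam. Reindexing the scale f by the enumeration of a club, all points of cofinality
   above lam become good. Fodor's lemma, and goodness at cofinalities above lam, give f restricted to
   any limit gamma a least upper bound h_gamma. Fix a square sequence C^d for each d in S' and let
   E_alpha consist of the limit ordinals gamma < alpha for which h_gamma(d) is, for almost all d, a limit
   point of the ladder of C^d at h_alpha(d). Coherence of the ladders gives E_alpha cut at gamma equal to
   E_gamma for every limit point gamma of E_alpha. If cf(alpha) > lam, exactness of h_alpha makes E_alpha
   club in alpha. As d has a cofinal subset of size at most lam while h_alpha(d) has cofinality above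
   lam, the ladder at h_alpha(d) has order type below d, so by Fodor it is bounded by some eta < kappa on
   a stationary set; E_alpha injects into the product of these short ladders, so |E_alpha| < kappa by the
   strong limit hypothesis. *)

theory Submission
  imports Defs
begin

section \<open>Order types and cofinality\<close>

lemma Field_ordrel [simp]: "Field (ordrel A) = A"
  by (auto simp: ordrel_def Field_def)

lemma well_order_on_ordrel [simp]: "well_order_on A (ordrel A)"
proof -
  have "wf (ordrel A - Id)"
    by (rule wf_subset[OF wellorder_class.wf]) (auto simp: ordrel_def)
  then show ?thesis
    unfolding well_order_on_def linear_order_on_def partial_order_on_def preorder_on_def
      refl_on_def trans_def antisym_def total_on_def Field_ordrel
    by (auto simp: ordrel_def)
qed

text \<open>Replaces isomorphism of well-order relations by an increasing bijection, the form in
  which order types are used from here on.\<close>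

lemma ordrel_ordIso_iff:
  "ordrel A =o ordrel B \<longleftrightarrow> (\<exists>f. bij_betw f A B \<and> strict_mono_on A f)"
proof
  assume "ordrel A =o ordrel B"
  then obtain f where "iso (ordrel A) (ordrel B) f" by (auto simp: ordIso_def)
  then have f: "bij_betw f A B" "\<And>a b. a \<in> A \<Longrightarrow> b \<in> A \<Longrightarrow> (a, b) \<in> ordrel A \<longleftrightarrow> (f a, f b) \<in> ordrel B"
    unfolding iso_iff2 by auto
  have "f x < f y" if "x \<in> A" "y \<in> A" "x < y" for x y
    using f(2)[of x y] f(2)[of y x] f(1) that by (auto simp: ordrel_def bij_betw_def)
  with f(1) show "\<exists>f. bij_betw f A B \<and> strict_mono_on A f" by (auto simp: strict_mono_on_def)
next
  assume "\<exists>f. bij_betw f A B \<and> strict_mono_on A f"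
  then obtain f where f: "bij_betw f A B" "strict_mono_on A f" by blast
  have "iso (ordrel A) (ordrel B) f"
    unfolding iso_iff2 Field_ordrel
    using f strict_mono_on_less_eq[OF f(2)] by (auto simp: ordrel_def bij_betw_def)
  then show "ordrel A =o ordrel B" by (auto simp: ordIso_def)
qed

text \<open>For \<open>D = UNIV\<close> this is the transitive collapse of \<open>A\<close>; for \<open>A = UNIV\<close> it is the increasing
  enumeration of \<open>D\<close>.\<close>

function enum :: "'a::wellorder set \<Rightarrow> 'a set \<Rightarrow> 'a \<Rightarrow> 'a" where
  "enum D A x = (LEAST y. y \<in> D \<and> (\<forall>z\<in>A \<inter> {..<x}. enum D A z < y))"
  by auto
termination
  by (relation "inv_image {(x, y). x < y} (\<lambda>(D, A, x). x)") (auto intro: wellorder_class.wf)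

declare enum.simps [simp del]

text \<open>The transitive collapse of A has an initial segment as its image. Since it never moves a
  point upwards, that segment ends at or below \<alpha>, so the required ordinal does exist in the
  type.\<close>

lemma otp_exists:
  fixes A :: "'a::wellorder set"
  assumes "A \<subseteq> {..<\<alpha>}"
  shows "\<exists>\<beta>\<le>\<alpha>. ordrel A =o ordrel {..<\<beta>}"
proof -
  let ?c = "enum UNIV A"
  \<comment> \<open>The three clauses are: values do not exceed arguments, which provides a witness
    for \<open>LEAST\<close>; values increase along A; no value is skipped.\<close>
  have c: "?c x \<le> x \<and> (\<forall>z\<in>A \<inter> {..<x}. ?c z < ?c x) \<and> (\<forall>y<?c x. \<exists>z\<in>A \<inter> {..<x}. y \<le> ?c z)" for x
  proof (induction x rule: less_induct)
    case (less x)
    let ?P = "\<lambda>y. y \<in> UNIV \<and> (\<forall>z\<in>A \<inter> {..<x}. ?c z < y)"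
    have e: "?c x = Least ?P" by (subst enum.simps) simp
    have P: "?P x" using less by fastforce
    show ?case
      unfolding e using Least_le[of ?P, OF P] LeastI[of ?P, OF P] not_less_Least[of _ ?P]
      by (meson UNIV_I leI)
  qed
  have bound: "\<forall>z\<in>A. ?c z < \<alpha>" using c assms by (meson le_less_trans lessThan_iff subsetD)
  define \<beta> where "\<beta> = (LEAST y. \<forall>z\<in>A. ?c z < y)"
  have \<beta>1: "\<beta> \<le> \<alpha>" unfolding \<beta>_def using bound by (rule Least_le)
  have \<beta>2: "\<forall>z\<in>A. ?c z < \<beta>" unfolding \<beta>_def using bound by (rule LeastI)
  have mono: "strict_mono_on A ?c" using c by (auto simp: strict_mono_on_def)
  have "y \<in> ?c ` A" if "y < \<beta>" for y
  proof -
    have ex: "\<exists>z. z \<in> A \<and> y \<le> ?c z" using not_less_Least[OF that[unfolded \<beta>_def]] by (meson leI)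
    \<comment> \<open>The first z whose value reaches y has value exactly y: a larger value would
      mean that an earlier element had already reached y.\<close>
    define z where "z = (LEAST z. z \<in> A \<and> y \<le> ?c z)"
    have z: "z \<in> A" "y \<le> ?c z" unfolding z_def using LeastI_ex[OF ex] by auto
    have "\<not> y < ?c z"
    proof
      assume "y < ?c z"
      then obtain z' where "z' \<in> A" "z' < z" "y \<le> ?c z'" using c[of z] by blast
      then show False using not_less_Least[of z' "\<lambda>z. z \<in> A \<and> y \<le> ?c z"] by (simp add: z_def)
    qed
    with z show ?thesis by force
  qed
  with \<beta>2 have "?c ` A = {..<\<beta>}" by auto
  with strict_mono_on_imp_inj_on[OF mono] have "bij_betw ?c A {..<\<beta>}" by (simp add: bij_betw_def)
  with mono \<beta>1 show ?thesis unfolding ordrel_ordIso_iff by blast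
qed

lemma otp_ordIso:
  fixes A :: "'a::wellorder set"
  assumes "A \<subseteq> {..<\<alpha>}"
  shows "ordrel A =o ordrel {..<otp A}"
  unfolding otp_def using otp_exists[OF assms] by (metis (mono_tags, lifting) LeastI)

lemma otp_iso:
  fixes A :: "'a::wellorder set"
  assumes "A \<subseteq> {..<\<alpha>}"
  obtains \<phi> where "bij_betw \<phi> A {..<otp A}" "strict_mono_on A \<phi>"
  using otp_ordIso[OF assms] unfolding ordrel_ordIso_iff by blast

lemma otp_card_ordIso:
  fixes A :: "'a::wellorder set"
  assumes "A \<subseteq> {..<\<alpha>}"
  shows "|A| =o |{..<otp A}|"
  by (rule otp_iso[OF assms]) (use card_of_ordIso in blast)

lemma otp_le_if_strict_mono:
  fixes A :: "'a::wellorder set" and \<phi> :: "'a \<Rightarrow> 'a"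
  assumes "strict_mono_on A \<phi>" "\<phi> ` A \<subseteq> {..<\<beta>}"
  shows "otp A \<le> \<beta>"
proof -
  have "bij_betw \<phi> A (\<phi> ` A)" by (simp add: assms strict_mono_on_imp_inj_on bij_betw_def)
  then have "ordrel A =o ordrel (\<phi> ` A)" unfolding ordrel_ordIso_iff using assms by blast
  moreover obtain \<gamma> where "\<gamma> \<le> \<beta>" "ordrel (\<phi> ` A) =o ordrel {..<\<gamma>}"
    using otp_exists[OF assms(2)] by blast
  ultimately show ?thesis
    unfolding otp_def by (meson Least_le ordIso_transitive order_trans)
qed

section \<open>Cofinality in terms of cardinality\<close>

lemma card_of_finite_ordLeq: "finite A \<Longrightarrow> infinite B \<Longrightarrow> |A| \<le>o |B|"
  using card_of_ordLeq_finite ordLeq_total card_of_Well_order by metis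

lemma card_of_Pow_ordLeq: "|A| \<le>o |B| \<Longrightarrow> |Pow A| \<le>o |Pow B|"
  unfolding card_of_ordLeq[symmetric] by (metis image_Pow_mono inj_on_image_Pow)

lemma card_of_lessThan_mono: "(a::'a::wellorder) \<le> b \<Longrightarrow> |{..<a}| \<le>o |{..<b}|"
  by (intro card_of_mono1) auto

text \<open>An unbounded set of small cardinality can be thinned to one of small order type: inject
  B into \<mu> and keep the elements that exceed every element with a smaller index.\<close>

lemma cof_le_if_card_le:
  fixes \<alpha> \<mu> :: "'a::wellorder"
  assumes B: "unbounded_in B \<alpha>" and le: "|B| \<le>o |{..<\<mu>}|"
  shows "cof \<alpha> \<le> \<mu>"
proof -
  obtain \<phi> where \<phi>: "inj_on \<phi> B" "\<phi> ` B \<subseteq> {..<\<mu>}"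
    using le unfolding card_of_ordLeq[symmetric] by blast
  define B' where "B' = {b\<in>B. \<forall>b'\<in>B. \<phi> b' < \<phi> b \<longrightarrow> b' < b}"
  have "\<phi> x < \<phi> y" if "x \<in> B'" "y \<in> B'" "x < y" for x y
  proof -
    have "\<phi> x \<noteq> \<phi> y" using that \<phi>(1) by (auto simp: B'_def inj_on_def)
    then show ?thesis using that unfolding B'_def by force
  qed
  then have mono: "strict_mono_on B' \<phi>" by (auto simp: strict_mono_on_def)
  have "\<exists>\<eta>\<in>B'. \<xi> \<le> \<eta>" if "\<xi> < \<alpha>" for \<xi>
  proof -
    have ex: "\<exists>b. b \<in> B \<and> \<xi> \<le> b" using B that by (auto simp: unbounded_in_def)
    \<comment> \<open>Among the elements of B from \<xi> on, the one with the least index survives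
      the thinning: anything with a smaller index lies below \<xi>.\<close>
    obtain b where b: "b \<in> B" "\<xi> \<le> b" and min: "\<And>y. y \<in> B \<and> \<xi> \<le> y \<Longrightarrow> \<phi> b \<le> \<phi> y"
    proof -
      let ?Q = "\<lambda>m. \<exists>b. b \<in> B \<and> \<xi> \<le> b \<and> m = \<phi> b"
      have "\<exists>m. ?Q m" using ex by blast
      from LeastI_ex[OF this] Least_le[of ?Q] that show thesis by metis
    qed
    have "b' < b" if "b' \<in> B" "\<phi> b' < \<phi> b" for b'
      using min[of b'] that b by force
    with b show ?thesis by (auto simp: B'_def)
  qed
  then have "unbounded_in B' \<alpha>" using B by (auto simp: unbounded_in_def B'_def)
  moreover have "otp B' \<le> \<mu>" using mono by (rule otp_le_if_strict_mono) (use \<phi> in \<open>auto simp: B'_def\<close>)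
  ultimately show ?thesis unfolding cof_def by (metis (mono_tags, lifting) Least_le order_trans)
qed

lemma cof_witness: "\<exists>A. unbounded_in A \<alpha> \<and> otp A = cof \<alpha>"
proof -
  have "unbounded_in {..<\<alpha>} \<alpha>" by (auto simp: unbounded_in_def)
  then show ?thesis unfolding cof_def by (intro LeastI_ex[of "\<lambda>\<beta>. \<exists>A. unbounded_in A \<alpha> \<and> otp A = \<beta>"]) blast
qed

text \<open>Turns the order-type definition of cofinality into a condition on cardinalities, so that
  images and preimages of cofinal sets can be compared without tracking their order.\<close>

lemma less_cof_iff:
  fixes \<mu> \<alpha> :: "'a::wellorder"
  shows "\<mu> < cof \<alpha> \<longleftrightarrow> (\<forall>B. unbounded_in B \<alpha> \<longrightarrow> \<not> |B| \<le>o |{..<\<mu>}| )"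
proof
  assume "\<mu> < cof \<alpha>"
  then show "\<forall>B. unbounded_in B \<alpha> \<longrightarrow> \<not> |B| \<le>o |{..<\<mu>}|" using cof_le_if_card_le by fastforce
next
  assume *: "\<forall>B. unbounded_in B \<alpha> \<longrightarrow> \<not> |B| \<le>o |{..<\<mu>}|"
  obtain A where A: "unbounded_in A \<alpha>" "otp A = cof \<alpha>" using cof_witness by blast
  have "|A| =o |{..<cof \<alpha>}|" using otp_card_ordIso[of A \<alpha>] A by (auto simp: unbounded_in_def)
  with * A(1) show "\<mu> < cof \<alpha>" by (meson card_of_lessThan_mono leI ordIso_ordLeq_trans)
qed

section \<open>Successor cardinals\<close>

text \<open>The proper initial segments of \<open>ordrel {..<\<kappa>}\<close> are the
  \<open>ordrel {..<a}\<close>. If the cardinal of \<kappa> were strictly shorter than this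
  well-order, it would be isomorphic to such a segment, and a would be equinumerous with
  \<kappa>.\<close>

lemma is_cardinal_iff:
  "is_cardinal \<kappa> \<longleftrightarrow> (\<forall>\<beta><\<kappa>. |{..<\<beta>}| <o |{..<\<kappa>}| )"
proof -
  have Re: "Restr (ordrel {..<\<kappa>}) (underS (ordrel {..<\<kappa>}) a) = ordrel {..<a}" if "a < \<kappa>" for a
    using that by (auto simp: ordrel_def underS_def)
  have u: "ordrel {..<a} <o ordrel {..<\<kappa>}" if "a < \<kappa>" for a
    using underS_Restr_ordLess[of "ordrel {..<\<kappa>}" a] Re[OF that] that by auto
  show ?thesis
  proof
    assume "is_cardinal \<kappa>"
    then have "ordrel {..<\<kappa>} =o |{..<\<kappa>}|"
      unfolding is_cardinal_def using card_of_Field_ordIso ordIso_symmetric by fastforce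
    moreover have "|{..<\<beta>}| \<le>o ordrel {..<\<beta>}" for \<beta> :: 'a
      by (rule card_of_least) simp
    ultimately show "\<forall>\<beta><\<kappa>. |{..<\<beta>}| <o |{..<\<kappa>}|"
      using u by (meson ordLeq_ordLess_trans ordLess_ordIso_trans)
  next
    assume *: "\<forall>\<beta><\<kappa>. |{..<\<beta>}| <o |{..<\<kappa>}|"
    have "|{..<\<kappa>}| =o ordrel {..<\<kappa>}"
    proof (rule ccontr)
      assume n: "\<not> ?thesis"
      have "|{..<\<kappa>}| \<le>o ordrel {..<\<kappa>}"
        by (rule card_of_least) simp
      with n have "|{..<\<kappa>}| <o ordrel {..<\<kappa>}" using ordLeq_iff_ordLess_or_ordIso by blast
      then obtain a where "a < \<kappa>" "|{..<\<kappa>}| =o ordrel {..<a}"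
        using internalize_ordLess ordLess_iff_ordIso_Restr[of "ordrel {..<\<kappa>}" "|{..<\<kappa>}|"] Re
        by (metis Field_ordrel well_order_on_ordrel card_of_Well_order lessThan_iff)
      then have "|{..<a}| =o |{..<\<kappa>}|"
        by (metis Field_card_of Field_ordrel card_of_cong ordIso_symmetric)
      with * \<open>a < \<kappa>\<close> show False by (meson not_ordLess_ordIso)
    qed
    then show "is_cardinal \<kappa>" unfolding is_cardinal_def using Card_order_ordIso2 card_of_Card_order by blast
  qed
qed

lemma succ_card_exists:
  fixes \<mu> :: "'a::wellorder"
  assumes "\<exists>\<nu>>\<mu>. is_cardinal \<nu>"
  shows "\<mu> < succ_card \<mu>" "is_cardinal (succ_card \<mu>)" "\<mu> < \<nu> \<Longrightarrow> is_cardinal \<nu> \<Longrightarrow> succ_card \<mu> \<le> \<nu>"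
  using LeastI_ex[OF assms] Least_le[of "\<lambda>\<nu>. \<mu> < \<nu> \<and> is_cardinal \<nu>"]
  unfolding succ_card_def by blast+

text \<open>The least ordinal equinumerous with b is a cardinal at most b, and no cardinal lies
  strictly between \<mu> and its successor.\<close>

lemma card_le_if_less_succ_card:
  fixes \<mu> :: "'a::wellorder"
  assumes "b < succ_card \<mu>"
  shows "|{..<b}| \<le>o |{..<\<mu>}|"
proof -
  define \<beta> where "\<beta> = (LEAST \<beta>::'a. |{..<\<beta>}| =o |{..<b}| )"
  have r: "|{..<b}| =o |{..<b}|" by (rule card_of_refl)
  have \<beta>: "|{..<\<beta>}| =o |{..<b}|" "\<beta> \<le> b"
    unfolding \<beta>_def using LeastI[of "\<lambda>\<beta>. |{..<\<beta>}| =o |{..<b}|", OF r]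
      Least_le[of "\<lambda>\<beta>. |{..<\<beta>}| =o |{..<b}|", OF r] by auto
  have "is_cardinal \<beta>"
    unfolding is_cardinal_iff
  proof (intro allI impI)
    fix \<gamma> assume "\<gamma> < \<beta>"
    then have "\<not> |{..<\<gamma>}| =o |{..<b}|" unfolding \<beta>_def by (rule not_less_Least)
    then have "\<not> |{..<\<gamma>}| =o |{..<\<beta>}|" using \<beta>(1) ordIso_transitive by blast
    moreover have "|{..<\<gamma>}| \<le>o |{..<\<beta>}|" using \<open>\<gamma> < \<beta>\<close> by (intro card_of_lessThan_mono) simp
    ultimately show "|{..<\<gamma>}| <o |{..<\<beta>}|" using ordLeq_iff_ordLess_or_ordIso by blast
  qed
  then have "\<beta> \<le> \<mu>"
    using assms \<beta>(2) not_less_Least[of \<beta> "\<lambda>\<nu>. \<mu> < \<nu> \<and> is_cardinal \<nu>"]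
    unfolding succ_card_def by (meson leI le_less_trans)
  then show ?thesis using \<beta>(1) by (meson card_of_lessThan_mono ordIso_ordLeq_trans ordIso_symmetric)
qed

text \<open>Regularity of successor cardinals: otherwise the successor would be a union of at most
  \<mu> initial segments, each of size at most \<mu>.\<close>

lemma bounded_in_succ_card:
  fixes \<mu> :: "'a::wellorder"
  assumes ex: "\<exists>\<nu>>\<mu>. is_cardinal \<nu>" and inf: "infinite {..<\<mu>}" and le: "|B| \<le>o |{..<\<mu>}|"
  shows "\<not> unbounded_in B (succ_card \<mu>)"
proof
  assume B: "unbounded_in B (succ_card \<mu>)"
  have "|{..x}| \<le>o |{..<\<mu>}|" if "x \<in> B" for x
  proof -
    have "{..x} = {x} \<union> {..<x}" by auto
    moreover have "|{..<x}| \<le>o |{..<\<mu>}|"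
      using B that by (intro card_le_if_less_succ_card) (auto simp: unbounded_in_def)
    moreover have "|{x}| \<le>o |{..<\<mu>}|" using inf by (simp add: card_of_finite_ordLeq)
    ultimately show ?thesis
      using inf card_of_Un_ordLeq_infinite_Field[OF _ _ _ card_of_Card_order, of "{..<\<mu>}" "{x}" "{..<x}"]
      by (metis Field_card_of)
  qed
  then have "|\<Union>x\<in>B. {..x}| \<le>o |{..<\<mu>}|"
    using card_of_UNION_ordLeq_infinite[OF inf le] by blast
  moreover have "{..<succ_card \<mu>} \<subseteq> (\<Union>x\<in>B. {..x})" using B by (auto simp: unbounded_in_def)
  ultimately have "|{..<succ_card \<mu>}| \<le>o |{..<\<mu>}|" using card_of_mono1 ordLeq_transitive by blast
  moreover have "|{..<\<mu>}| <o |{..<succ_card \<mu>}|"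
    using succ_card_exists(1,2)[OF ex] unfolding is_cardinal_iff by blast
  ultimately show False using not_ordLess_ordLeq by blast
qed

text \<open>Zero and successor ordinals have a finite unbounded subset.\<close>

lemma limit_point_if_less_cof:
  fixes \<alpha> :: "'a::wellorder"
  assumes inf: "infinite {..<\<mu>}" and less: "\<mu> < cof \<alpha>"
  shows "limit_point \<alpha> UNIV"
proof (rule ccontr)
  assume "\<not> limit_point \<alpha> UNIV"
  then consider "{..<\<alpha>} = {}" | \<xi> where "\<xi> < \<alpha>" "\<forall>\<eta>. \<not> (\<xi> < \<eta> \<and> \<eta> < \<alpha>)"
    unfolding limit_point_def by blast
  then have "\<exists>B. unbounded_in B \<alpha> \<and> finite B"
  proof cases
    case 1
    then have "unbounded_in {} \<alpha>" by (auto simp: unbounded_in_def)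
    then show ?thesis by blast
  next
    case (2 \<xi>)
    then have "unbounded_in {\<xi>} \<alpha>" by (auto simp: unbounded_in_def not_less)
    then show ?thesis by blast
  qed
  then show False
    using less inf unfolding less_cof_iff by (meson card_of_finite_ordLeq)
qed

lemma not_unbounded_less_cof:
  fixes \<alpha> :: "'a::wellorder"
  assumes "\<mu> < cof \<alpha>" "|B| \<le>o |{..<\<mu>}|" "B \<subseteq> {..<\<alpha>}"
  shows "\<exists>\<xi><\<alpha>. \<forall>b\<in>B. b < \<xi>"
  using assms unfolding less_cof_iff unbounded_in_def by (meson leI)

text \<open>Send \<delta> to the first element of A at or above it. Two limit points of A have an
  element of A between them, so their images differ. This later lets the stationary set be thinned
  to size at most the cofinality of \<kappa>.\<close>

lemma card_limit_points:
  fixes A :: "'a::wellorder set"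
  assumes A: "unbounded_in A \<kappa>" and S: "S \<subseteq> {..<\<kappa>}"
  shows "|{\<delta>\<in>S. limit_point \<delta> A}| \<le>o |A|"
proof -
  define p where "p \<delta> = (LEAST a. a \<in> A \<and> \<delta> \<le> a)" for \<delta>
  have p: "p \<delta> \<in> A" "\<delta> \<le> p \<delta>" if "\<delta> \<in> S" for \<delta>
  proof -
    have "\<exists>a. a \<in> A \<and> \<delta> \<le> a" using A S that by (auto simp: unbounded_in_def)
    from LeastI_ex[OF this] show "p \<delta> \<in> A" "\<delta> \<le> p \<delta>" by (auto simp: p_def)
  qed
  have neq: "p \<gamma> \<noteq> p \<delta>" if \<gamma>: "\<gamma> \<in> S" "\<delta> \<in> S" "limit_point \<delta> A" "\<gamma> < \<delta>" for \<gamma> \<delta>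
  proof -
    obtain a where "a \<in> A" "\<gamma> < a" "a < \<delta>" using \<gamma> unfolding limit_point_def by blast
    then have "p \<gamma> \<le> a" unfolding p_def by (intro Least_le) auto
    then show ?thesis using p(2)[OF \<gamma>(2)] \<open>a < \<delta>\<close> by auto
  qed
  have "inj_on p {\<delta>\<in>S. limit_point \<delta> A}"
    unfolding inj_on_def using neq by (smt (verit, best) linorder_neqE mem_Collect_eq)
  moreover have "p ` {\<delta>\<in>S. limit_point \<delta> A} \<subseteq> A" using p by auto
  ultimately show ?thesis using card_of_ordLeq by blast
qed

section \<open>Enumerating a club of a regular cardinal\<close>

text \<open>In use \<nu> is the successor of \<mu> = \<kappa>; the last two assumptions are what its
  enumeration needs from regularity.\<close>

locale club_enumeration =
  fixes \<mu> \<nu> :: "'a::wellorder" and D :: "'a set"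
  assumes D: "club_in D \<nu>"
    and initial_small: "b < \<nu> \<Longrightarrow> |{..<b}| \<le>o |{..<\<mu>}|"
    and regular: "|B| \<le>o |{..<\<mu>}| \<Longrightarrow> \<not> unbounded_in B \<nu>"
begin

abbreviation d :: "'a \<Rightarrow> 'a" where "d \<equiv> enum D UNIV"

text \<open>Fewer than \<nu> values precede stage \<alpha>, so they are bounded below \<nu> and the
  unbounded set D supplies a candidate for \<open>LEAST\<close>.\<close>

lemma d_mem: "\<alpha> < \<nu> \<Longrightarrow> d \<alpha> \<in> D \<and> (\<forall>\<beta><\<alpha>. d \<beta> < d \<alpha>)"
proof (induction \<alpha> rule: less_induct)
  case (less \<alpha>)
  let ?P = "\<lambda>y. y \<in> D \<and> (\<forall>z\<in>UNIV \<inter> {..<\<alpha>}. d z < y)"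
  have e: "d \<alpha> = Least ?P" by (rule enum.simps)
  have "|d ` {..<\<alpha>}| \<le>o |{..<\<mu>}|"
    using initial_small[OF less.prems] card_of_image ordLeq_transitive by blast
  moreover have "d ` {..<\<alpha>} \<subseteq> {..<\<nu>}"
  proof
    fix y assume "y \<in> d ` {..<\<alpha>}"
    then have "y \<in> D" using less.IH less.prems by auto
    then show "y \<in> {..<\<nu>}" using D by (auto simp: club_in_def unbounded_in_def)
  qed
  ultimately obtain \<xi> where \<xi>: "\<xi> < \<nu>" "\<forall>\<beta><\<alpha>. d \<beta> < \<xi>"
    using regular unfolding unbounded_in_def by (metis image_eqI leI lessThan_iff)
  then obtain y where "y \<in> D" "\<xi> \<le> y" using D by (auto simp: club_in_def unbounded_in_def)
  then have "?P y" using \<xi>(2) by auto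
  then have "?P (d \<alpha>)" unfolding e by (rule LeastI[of ?P])
  then show ?case by auto
qed

lemma d_less: "\<alpha> < \<nu> \<Longrightarrow> d \<alpha> < \<nu>"
  using d_mem D by (auto simp: club_in_def unbounded_in_def)

lemma d_mono: "\<beta> < \<alpha> \<Longrightarrow> \<alpha> < \<nu> \<Longrightarrow> d \<beta> < d \<alpha>"
  using d_mem by blast

text \<open>Otherwise the supremum s of the earlier values lies below \<open>d \<alpha>\<close>. It
  is a limit point of D, hence in D by closure, and is itself a candidate in the
  \<open>LEAST\<close> that defines \<open>d \<alpha>\<close>.\<close>

lemma d_continuous:
  assumes \<alpha>: "\<alpha> < \<nu>" "limit_point \<alpha> UNIV" and x: "x < d \<alpha>"
  shows "\<exists>\<beta><\<alpha>. x \<le> d \<beta>"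
proof (rule ccontr)
  assume "\<not> ?thesis"
  then have bound: "\<forall>\<beta><\<alpha>. d \<beta> < x" by auto
  define s where "s = (LEAST s. \<forall>\<beta><\<alpha>. d \<beta> < s)"
  have s: "\<forall>\<beta><\<alpha>. d \<beta> < s" unfolding s_def by (rule LeastI[of "\<lambda>s. \<forall>\<beta><\<alpha>. d \<beta> < s"]) (rule bound)
  have "s \<le> x" unfolding s_def by (rule Least_le) (rule bound)
  then have sd: "s < d \<alpha>" using x by simp
  then have "s < \<nu>" using d_less[OF \<alpha>(1)] by simp
  moreover have "limit_point s D"
    unfolding limit_point_def
  proof (intro conjI allI impI)
    show "{..<s} \<noteq> {}" using s \<alpha>(2) by (auto simp: limit_point_def)
    fix \<xi> assume "\<xi> < s"
    then obtain \<beta> where \<beta>: "\<beta> < \<alpha>" "\<xi> \<le> d \<beta>"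
      using not_less_Least[of \<xi> "\<lambda>s. \<forall>\<beta><\<alpha>. d \<beta> < s"] unfolding s_def by (meson leI)
    then obtain \<beta>' where "\<beta> < \<beta>'" "\<beta>' < \<alpha>" using \<alpha>(2) unfolding limit_point_def by blast
    then have "d \<beta>' \<in> D" "\<xi> < d \<beta>'" "d \<beta>' < s"
      using d_mem[of \<beta>'] \<beta> s \<alpha>(1) by (meson le_less_trans less_trans)+
    then show "\<exists>\<eta>\<in>D. \<xi> < \<eta> \<and> \<eta> < s" by blast
  qed
  ultimately have "s \<in> D" using D by (auto simp: club_in_def)
  then have "d \<alpha> \<le> s" unfolding enum.simps[of D UNIV \<alpha>] using s by (intro Least_le) auto
  then show False using sd by simp
qed

text \<open>A small cofinal subset of \<open>d \<alpha>\<close> would pull back, by continuity, to a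
  small cofinal subset of \<alpha>. Reindexing by a club therefore keeps cofinalities large.\<close>

lemma less_cof_d:
  assumes \<alpha>: "\<alpha> < \<nu>" "limit_point \<alpha> UNIV" and cof: "lam < cof \<alpha>"
  shows "lam < cof (d \<alpha>)"
  unfolding less_cof_iff
proof (intro allI impI notI)
  fix B assume B: "unbounded_in B (d \<alpha>)" "|B| \<le>o |{..<lam}|"
  have "\<forall>b\<in>B. \<exists>\<beta><\<alpha>. b \<le> d \<beta>" using d_continuous[OF \<alpha>] B(1) by (auto simp: unbounded_in_def)
  then obtain p where p: "\<And>b. b \<in> B \<Longrightarrow> p b < \<alpha> \<and> b \<le> d (p b)" by metis
  have "|p ` B| \<le>o |{..<lam}|" using B(2) card_of_image ordLeq_transitive by blast
  then obtain \<xi> where \<xi>: "\<xi> < \<alpha>" "\<forall>b\<in>p ` B. b < \<xi>"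
    using not_unbounded_less_cof[OF cof, of "p ` B"] p by blast
  obtain b where b: "b \<in> B" "d \<xi> \<le> b"
    using B(1) d_mono[OF \<xi>(1) \<alpha>(1)] by (auto simp: unbounded_in_def)
  have "d (p b) < d \<xi>" using \<xi> b(1) \<alpha>(1) by (intro d_mono) auto
  then show False using p[OF b(1)] b(2) by auto
qed

end

section \<open>The club filter\<close>

text \<open>For S below \<kappa>, \<open>eventually\<close> means on the trace of a club on S, and
  \<open>frequently\<close> means on a stationary subset of S.\<close>

definition club_filter :: "'a::wellorder \<Rightarrow> 'a set \<Rightarrow> 'a filter" where
  "club_filter \<kappa> S = Abs_filter (\<lambda>P. \<exists>C. club_in C \<kappa> \<and> (\<forall>\<delta>\<in>C \<inter> S. P \<delta>))"

text \<open>For A of order type the cofinality of \<kappa>, \<open>small\<close> expresses that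
  proper initial segments of A are too short for their images to be cofinal;
  \<open>seq_bounded\<close> excludes countable cofinality.\<close>

locale uncountable_cofinality =
  fixes \<kappa> :: "'a::wellorder" and A :: "'a set"
  assumes unbounded_A: "unbounded_in A \<kappa>"
    and small: "x < \<kappa> \<Longrightarrow> (\<And>a. a \<in> A \<Longrightarrow> a < x \<Longrightarrow> g a < \<kappa>) \<Longrightarrow> \<exists>y<\<kappa>. \<forall>a\<in>A. a < x \<longrightarrow> g a < y"
    and seq_bounded: "(\<And>n::nat. u n < \<kappa>) \<Longrightarrow> \<exists>y<\<kappa>. \<forall>n. u n < y"
begin

lemma ex_greater: "x < \<kappa> \<Longrightarrow> \<exists>y<\<kappa>. x < y"
  using seq_bounded[of "\<lambda>_. x"] by blast

lemma unbounded_in_less: "unbounded_in C \<kappa> \<Longrightarrow> x < \<kappa> \<Longrightarrow> \<exists>c\<in>C. x < c \<and> c < \<kappa>"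
  using ex_greater[of x] unfolding unbounded_in_def by (metis lessThan_iff less_le_trans subsetD)

text \<open>Iterate \<open>Q\<close> along an \<omega>-sequence and take its supremum, which is
  below \<kappa> by uncountable cofinality. Monotonicity of \<open>Q\<close> carries the closure
  property from the sequence to all points below the supremum. Every club constructed below, apart
  from end segments, arises this way.\<close>

lemma club_closure_points:
  assumes Q: "\<And>x. x < \<kappa> \<Longrightarrow> \<exists>y<\<kappa>. Q x y"
    and mono: "\<And>x x' y y'. Q x y \<Longrightarrow> x' \<le> x \<Longrightarrow> y \<le> y' \<Longrightarrow> Q x' y'"
  shows "club_in {\<delta>. \<delta> < \<kappa> \<and> {..<\<delta>} \<noteq> {} \<and> (\<forall>x<\<delta>. \<exists>y<\<delta>. x < y \<and> Q x y)} \<kappa>"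
    (is "club_in ?C \<kappa>")
proof -
  have step: "\<exists>y. y < \<kappa> \<and> x < y \<and> Q x y" if x: "x < \<kappa>" for x
  proof -
    obtain y where y: "y < \<kappa>" "Q x y" using Q[OF x] by blast
    moreover obtain z where "z < \<kappa>" "x < z" using ex_greater[OF x] by blast
    ultimately have "max y z < \<kappa>" "x < max y z" "Q x (max y z)"
      using mono[of x y x "max y z"] by (auto simp: less_max_iff_disj)
    then show ?thesis by blast
  qed
  have "\<exists>\<delta>\<in>?C. \<xi> \<le> \<delta>" if \<xi>: "\<xi> < \<kappa>" for \<xi>
  proof -
    have "\<exists>u. \<forall>n. (u n < \<kappa> \<and> (n = 0 \<longrightarrow> u n = \<xi>)) \<and> (u n < u (Suc n) \<and> Q (u n) (u (Suc n)))"
      by (rule dependent_nat_choice) (use \<xi> step in blast)+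
    then obtain u where u: "\<And>n. u n < \<kappa>" "u 0 = \<xi>" "\<And>n. u n < u (Suc n)" "\<And>n. Q (u n) (u (Suc n))"
      by blast
    obtain y where y: "y < \<kappa>" "\<forall>n. u n < y" using seq_bounded[of u, OF u(1)] by blast
    define \<delta> where "\<delta> = (LEAST y. \<forall>n. u n < y)"
    have \<delta>: "\<forall>n. u n < \<delta>" unfolding \<delta>_def by (rule LeastI[of "\<lambda>y. \<forall>n. u n < y"]) (rule y(2))
    have "\<delta> \<le> y" unfolding \<delta>_def by (rule Least_le) (rule y(2))
    then have "\<delta> < \<kappa>" using y by simp
    moreover have "\<exists>y<\<delta>. x < y \<and> Q x y" if "x < \<delta>" for x
    proof -
      have "\<not> (\<forall>n. u n < x)" using that unfolding \<delta>_def by (rule not_less_Least)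
      then obtain n where n: "x \<le> u n" by (meson leI)
      then have "Q x (u (Suc n))" "x < u (Suc n)" using mono[OF u(4)[of n] n order_refl] u(3)[of n] by auto
      then show ?thesis using \<delta> by blast
    qed
    ultimately show ?thesis using \<delta> u(2) by (auto intro!: bexI[of _ \<delta>] less_imp_le)
  qed
  moreover have "\<gamma> \<in> ?C" if "\<gamma> < \<kappa>" "limit_point \<gamma> ?C" for \<gamma>
    using that unfolding limit_point_def by simp (meson less_trans)
  ultimately show ?thesis unfolding club_in_def unbounded_in_def by blast
qed

text \<open>A closure point of "both sets have an element in between" is a limit point of both,
  hence a member of both.\<close>

lemma club_inter:
  assumes C: "club_in C \<kappa>" and D: "club_in D \<kappa>"
  shows "\<exists>E. club_in E \<kappa> \<and> E \<subseteq> C \<inter> D"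
proof -
  let ?Q = "\<lambda>x y. (\<exists>c\<in>C. x < c \<and> c < y) \<and> (\<exists>d\<in>D. x < d \<and> d < y)"
  let ?E = "{\<delta>. \<delta> < \<kappa> \<and> {..<\<delta>} \<noteq> {} \<and> (\<forall>x<\<delta>. \<exists>y<\<delta>. x < y \<and> ?Q x y)}"
  have "club_in ?E \<kappa>"
  proof (rule club_closure_points)
    fix x assume x: "x < \<kappa>"
    obtain c d where cd: "c \<in> C" "x < c" "c < \<kappa>" "d \<in> D" "x < d" "d < \<kappa>"
      using C D unbounded_in_less[OF _ x] unfolding club_in_def by metis
    then obtain y where "y < \<kappa>" "max c d < y" using ex_greater[of "max c d"] by auto
    then show "\<exists>y<\<kappa>. ?Q x y" using cd by (metis max_less_iff_conj)
  next
    fix x x' y y' assume "?Q x y" "x' \<le> x" "y \<le> y'"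
    then show "?Q x' y'" by (meson le_less_trans less_le_trans)
  qed
  moreover have "limit_point \<delta> C" "limit_point \<delta> D" "\<delta> < \<kappa>" if "\<delta> \<in> ?E" for \<delta>
    using that unfolding limit_point_def by simp_all (meson less_trans)+
  ultimately show ?thesis using C D unfolding club_in_def by blast
qed

lemma club_UNIV: "club_in {..<\<kappa>} \<kappa>"
  by (auto simp: club_in_def unbounded_in_def)

lemma eventually_club_filter:
  "eventually P (club_filter \<kappa> S) \<longleftrightarrow> (\<exists>C. club_in C \<kappa> \<and> (\<forall>\<delta>\<in>C \<inter> S. P \<delta>))"
  unfolding club_filter_def
proof (rule eventually_Abs_filter, unfold_locales)
  show "\<exists>C. club_in C \<kappa> \<and> (\<forall>\<delta>\<in>C \<inter> S. True)" using club_UNIV by blast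
next
  fix P Q
  assume "\<exists>C. club_in C \<kappa> \<and> (\<forall>\<delta>\<in>C \<inter> S. P \<delta>)" "\<exists>C. club_in C \<kappa> \<and> (\<forall>\<delta>\<in>C \<inter> S. Q \<delta>)"
  then obtain C D where "club_in C \<kappa>" "\<forall>\<delta>\<in>C \<inter> S. P \<delta>" "club_in D \<kappa>" "\<forall>\<delta>\<in>D \<inter> S. Q \<delta>" by blast
  then show "\<exists>C. club_in C \<kappa> \<and> (\<forall>\<delta>\<in>C \<inter> S. P \<delta> \<and> Q \<delta>)" using club_inter[of C D] by blast
next
  fix P Q
  assume "\<forall>x. P x \<longrightarrow> Q x" "\<exists>C. club_in C \<kappa> \<and> (\<forall>\<delta>\<in>C \<inter> S. P \<delta>)"
  then show "\<exists>C. club_in C \<kappa> \<and> (\<forall>\<delta>\<in>C \<inter> S. Q \<delta>)" by blast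
qed

lemma eventually_mem: "eventually (\<lambda>\<delta>. \<delta> \<in> S) (club_filter \<kappa> S)"
  unfolding eventually_club_filter using club_UNIV by blast

lemma eventually_greater: "j < \<kappa> \<Longrightarrow> eventually (\<lambda>\<delta>. j < \<delta>) (club_filter \<kappa> S)"
  unfolding eventually_club_filter
proof (intro exI conjI)
  assume j: "j < \<kappa>"
  have "\<exists>\<eta>. j < \<eta> \<and> \<eta> < \<kappa> \<and> \<xi> \<le> \<eta>" if "\<xi> < \<kappa>" for \<xi>
    using ex_greater[of "max j \<xi>"] j that by (metis less_imp_le max_less_iff_conj)
  then show "club_in {j<..<\<kappa>} \<kappa>"
    unfolding club_in_def unbounded_in_def limit_point_def by (fastforce dest: less_trans)
qed auto

text \<open>Normality of the club filter for diagonal intersections indexed by A: below any x there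
  are so few indices that the next elements of all the clubs concerned are bounded together.\<close>

lemma eventually_diagonal:
  assumes P: "\<And>a. a \<in> A \<Longrightarrow> eventually (P a) (club_filter \<kappa> S)"
  shows "eventually (\<lambda>\<delta>. \<forall>a\<in>A. a < \<delta> \<longrightarrow> P a \<delta>) (club_filter \<kappa> S)"
proof -
  have "\<forall>a\<in>A. \<exists>C. club_in C \<kappa> \<and> (\<forall>\<delta>\<in>C \<inter> S. P a \<delta>)" using P unfolding eventually_club_filter by blast
  then obtain D where D: "\<And>a. a \<in> A \<Longrightarrow> club_in (D a) \<kappa>" "\<And>a. a \<in> A \<Longrightarrow> \<forall>\<delta>\<in>D a \<inter> S. P a \<delta>"
    by metis
  let ?Q = "\<lambda>x y. \<forall>a\<in>A. a \<le> x \<longrightarrow> (\<exists>c\<in>D a. x < c \<and> c < y)"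
  let ?E = "{\<delta>. \<delta> < \<kappa> \<and> {..<\<delta>} \<noteq> {} \<and> (\<forall>x<\<delta>. \<exists>y<\<delta>. x < y \<and> ?Q x y)}"
  have club: "club_in ?E \<kappa>"
  proof (rule club_closure_points)
    fix x assume x: "x < \<kappa>"
    obtain x' where x': "x' < \<kappa>" "x < x'" using ex_greater[OF x] by blast
    have "\<forall>a\<in>A. \<exists>c. c \<in> D a \<and> x < c \<and> c < \<kappa>"
      using D(1) unbounded_in_less[OF _ x] unfolding club_in_def by metis
    then obtain c where c: "\<And>a. a \<in> A \<Longrightarrow> c a \<in> D a \<and> x < c a \<and> c a < \<kappa>" by metis
    obtain y where "y < \<kappa>" "\<forall>a\<in>A. a < x' \<longrightarrow> c a < y" using small[of x' c] x'(1) c by blast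
    then show "\<exists>y<\<kappa>. ?Q x y" using c x'(2) by (metis le_less_trans)
  next
    fix x x' y y' assume "?Q x y" "x' \<le> x" "y \<le> y'"
    then show "?Q x' y'" by (meson le_less_trans less_le_trans order_trans)
  qed
  have "\<delta> \<in> D a" if \<delta>: "\<delta> \<in> ?E" and a: "a \<in> A" "a < \<delta>" for \<delta> a
  proof -
    have "\<exists>c\<in>D a. x < c \<and> c < \<delta>" if "x < \<delta>" for x
    proof -
      have "max x a < \<delta>" using that a by simp
      then obtain y where "y < \<delta>" "?Q (max x a) y" using \<delta> by blast
      then obtain c where "c \<in> D a" "max x a < c" "c < y" using a by (meson max.cobounded2)
      then show ?thesis using \<open>y < \<delta>\<close> by (metis less_trans max_less_iff_conj)
    qed
    then have "limit_point \<delta> (D a)" using a(2) by (auto simp: limit_point_def)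
    then show ?thesis using D(1)[OF a(1)] \<delta> by (auto simp: club_in_def)
  qed
  then show ?thesis unfolding eventually_club_filter using club D(2) by blast
qed

text \<open>Fodor's lemma for singular \<open>\<kappa>\<close>: the regressive function takes its values in \<open>A\<close>.\<close>

lemma frequently_pressing_down:
  assumes "frequently (\<lambda>\<delta>. \<exists>a\<in>A. a < \<delta> \<and> P a \<delta>) (club_filter \<kappa> S)"
  shows "\<exists>a\<in>A. frequently (P a) (club_filter \<kappa> S)"
  using eventually_diagonal[of "\<lambda>a \<delta>. \<not> P a \<delta>" S] assms unfolding frequently_def by auto

lemma club_limit_points: "\<exists>C. club_in C \<kappa> \<and> (\<forall>\<delta>\<in>C. limit_point \<delta> A)"
proof -
  let ?Q = "\<lambda>x y. \<exists>a\<in>A. x < a \<and> a < y"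
  let ?E = "{\<delta>. \<delta> < \<kappa> \<and> {..<\<delta>} \<noteq> {} \<and> (\<forall>x<\<delta>. \<exists>y<\<delta>. x < y \<and> ?Q x y)}"
  have "club_in ?E \<kappa>"
  proof (rule club_closure_points)
    fix x assume "x < \<kappa>"
    then obtain a where "a \<in> A" "x < a" "a < \<kappa>" using unbounded_in_less[OF unbounded_A] by blast
    then show "\<exists>y<\<kappa>. ?Q x y" using ex_greater[of a] by blast
  next
    fix x x' y y' assume "?Q x y" "x' \<le> x" "y \<le> y'"
    then show "?Q x' y'" by (meson le_less_trans less_le_trans)
  qed
  moreover have "limit_point \<delta> A" if "\<delta> \<in> ?E" for \<delta>
    using that unfolding limit_point_def by simp (meson less_trans)
  ultimately show ?thesis by blast
qed

lemma club_filter_neq_bot: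
  assumes "stationary_in S \<kappa>"
  shows "club_filter \<kappa> {\<delta>\<in>S. limit_point \<delta> A} \<noteq> bot"
proof -
  obtain C where C: "club_in C \<kappa>" "\<forall>\<delta>\<in>C. limit_point \<delta> A" using club_limit_points by blast
  have "\<not> eventually (\<lambda>_. False) (club_filter \<kappa> {\<delta>\<in>S. limit_point \<delta> A})"
  proof
    assume "eventually (\<lambda>_. False) (club_filter \<kappa> {\<delta>\<in>S. limit_point \<delta> A})"
    then obtain D where D: "club_in D \<kappa>" "\<forall>\<delta>\<in>D \<inter> {\<delta>\<in>S. limit_point \<delta> A}. False"
      unfolding eventually_club_filter by blast
    obtain E where "club_in E \<kappa>" "E \<subseteq> C \<inter> D" using club_inter[OF C(1) D(1)] by blast
    then show False using assms C(2) D(2) unfolding stationary_in_def by blast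
  qed
  then show ?thesis by (metis eventually_bot)
qed

end

section \<open>Least upper bounds modulo the club filter\<close>

text \<open>The bound u guarantees that \<open>LEAST\<close> has a witness, so that it really is the
  supremum of X.\<close>

lemma Sup_least:
  fixes X :: "'a::wellorder set"
  assumes "\<forall>x\<in>X. x \<le> u"
  shows "x \<in> X \<Longrightarrow> x \<le> (LEAST s. \<forall>x\<in>X. x \<le> s)"
    and "g < (LEAST s. \<forall>x\<in>X. x \<le> s) \<Longrightarrow> \<exists>x\<in>X. g < x"
proof -
  show "x \<le> (LEAST s. \<forall>x\<in>X. x \<le> s)" if "x \<in> X"
    using LeastI[of "\<lambda>s. \<forall>x\<in>X. x \<le> s", OF assms] that by blast
  show "\<exists>x\<in>X. g < x" if "g < (LEAST s. \<forall>x\<in>X. x \<le> s)"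
    using not_less_Least[OF that] by (meson leI)
qed

text \<open>In use S is the stationary set thinned to limit points of A, f is the scale reindexed by
  a club, and \<open>Cs \<delta>\<close> is a chosen square sequence. The assumption
  \<open>good\<close> is goodness already converted into an exact upper bound of large
  cofinality.\<close>

locale good_sequence = uncountable_cofinality \<kappa> A for \<kappa> :: "'a::wellorder" and A +
  fixes S :: "'a set" and lam \<nu> :: 'a and f :: "'a \<Rightarrow> 'a \<Rightarrow> 'a" and Cs :: "'a \<Rightarrow> 'a \<Rightarrow> 'a set" and F
  assumes S_below: "S \<subseteq> {..<\<kappa>}"
    and S_limit: "\<delta> \<in> S \<Longrightarrow> limit_point \<delta> A"
    and card_S: "|S| \<le>o |{..<lam}|"
    and card_A: "|A| =o |{..<lam}|"
    and inf_lam: "infinite {..<lam}"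
    and lam_less: "lam < \<kappa>"
    and F_def: "F = club_filter \<kappa> S"
    and F_neq_bot: "F \<noteq> bot"
    and f_increasing: "\<beta> < \<alpha> \<Longrightarrow> \<alpha> < \<nu> \<Longrightarrow> eventually (\<lambda>\<delta>. f \<beta> \<delta> < f \<alpha> \<delta>) F"
    and f_bound: "\<alpha> < \<nu> \<Longrightarrow> \<delta> \<in> S \<Longrightarrow> f \<alpha> \<delta> < succ_card \<delta>"
    and good: "\<alpha> < \<nu> \<Longrightarrow> lam < cof \<alpha> \<Longrightarrow> \<exists>h. (\<forall>\<beta><\<alpha>. eventually (\<lambda>\<delta>. f \<beta> \<delta> < h \<delta>) F)
       \<and> (\<forall>g. \<exists>\<beta><\<alpha>. eventually (\<lambda>\<delta>. g \<delta> < h \<delta> \<longrightarrow> g \<delta> < f \<beta> \<delta>) F)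
       \<and> eventually (\<lambda>\<delta>. lam < cof (h \<delta>)) F"
    and square: "\<delta> \<in> S \<Longrightarrow> \<alpha> \<in> lim_below (succ_card \<delta>) \<Longrightarrow> club_in (Cs \<delta> \<alpha>) \<alpha> \<and> otp (Cs \<delta> \<alpha>) \<le> \<delta> \<and>
       (\<forall>\<beta><\<alpha>. limit_point \<beta> (Cs \<delta> \<alpha>) \<longrightarrow> Cs \<delta> \<alpha> \<inter> {..<\<beta>} = Cs \<delta> \<beta>)"
    and strong_limit: "\<mu> < \<kappa> \<Longrightarrow> |Pow {..<\<mu>}| <o |{..<\<kappa>}|"
begin

lemmas eventually_S = eventually_mem[of S, folded F_def]
  and eventually_gt = eventually_greater[of _ S, folded F_def]
  and pressing_down = frequently_pressing_down[of _ S, folded F_def]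

text \<open>Leastness is phrased with stationary sets: a function below h on a stationary set is
  below some earlier f on a stationary set. This fixes h modulo F. At large cofinality exactness is
  added: one earlier f works almost everywhere that g is below h.\<close>

definition is_lub :: "'a \<Rightarrow> ('a \<Rightarrow> 'a) \<Rightarrow> bool" where
  "is_lub \<gamma> h \<longleftrightarrow> (\<forall>\<beta><\<gamma>. eventually (\<lambda>\<delta>. f \<beta> \<delta> < h \<delta>) F) \<and>
     (\<forall>g. frequently (\<lambda>\<delta>. g \<delta> < h \<delta>) F \<longrightarrow> (\<exists>\<beta><\<gamma>. frequently (\<lambda>\<delta>. g \<delta> < f \<beta> \<delta>) F)) \<and>
     (lam < cof \<gamma> \<longrightarrow> (\<forall>g. \<exists>\<beta><\<gamma>. eventually (\<lambda>\<delta>. g \<delta> < h \<delta> \<longrightarrow> g \<delta> < f \<beta> \<delta>) F)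
       \<and> eventually (\<lambda>\<delta>. lam < cof (h \<delta>)) F)"

text \<open>At cofinality at most \<open>lam\<close> the supremum is taken along a diagonal, so that Fodor's lemma shows it to be
  least.\<close>

lemma ex_lub:
  assumes \<gamma>: "\<gamma> < \<nu>" "limit_point \<gamma> UNIV"
  shows "\<exists>h. is_lub \<gamma> h"
proof (cases "lam < cof \<gamma>")
  case True
  obtain h where h: "\<forall>\<beta><\<gamma>. eventually (\<lambda>\<delta>. f \<beta> \<delta> < h \<delta>) F"
    "\<forall>g. \<exists>\<beta><\<gamma>. eventually (\<lambda>\<delta>. g \<delta> < h \<delta> \<longrightarrow> g \<delta> < f \<beta> \<delta>) F"
    "eventually (\<lambda>\<delta>. lam < cof (h \<delta>)) F"
    using good[OF \<gamma>(1) True] by blast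
  have "\<exists>\<beta><\<gamma>. frequently (\<lambda>\<delta>. g \<delta> < f \<beta> \<delta>) F" if g: "frequently (\<lambda>\<delta>. g \<delta> < h \<delta>) F" for g
  proof -
    obtain \<beta> where \<beta>: "\<beta> < \<gamma>" "eventually (\<lambda>\<delta>. g \<delta> < h \<delta> \<longrightarrow> g \<delta> < f \<beta> \<delta>) F"
      using h(2) by blast
    show ?thesis using frequently_rev_mp[OF g \<beta>(2)] \<beta>(1) by blast
  qed
  with h show ?thesis unfolding is_lub_def by blast
next
  case False
  obtain B where B: "unbounded_in B \<gamma>" "otp B = cof \<gamma>" using cof_witness by blast
  have "|B| =o |{..<cof \<gamma>}|" using B otp_card_ordIso[of B \<gamma>] by (auto simp: unbounded_in_def)
  then have "|B| \<le>o |A|"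
    using False card_of_lessThan_mono[of "cof \<gamma>" lam] card_A
    by (meson leI ordIso_ordLeq_trans ordIso_symmetric ordLeq_ordIso_trans)
  moreover have "B \<noteq> {}" using B(1) \<gamma>(2) by (auto simp: unbounded_in_def limit_point_def)
  \<comment> \<open>A cofinal subset of \<gamma> is indexed by A, because A contains the possible
    values of the regressive functions in Fodor's lemma.\<close>
  ultimately obtain \<psi> where \<psi>: "\<psi> ` A = B" using card_of_ordLeq2 by metis
  have \<psi>_less: "\<psi> a < \<gamma>" if "a \<in> A" for a using that \<psi> B(1) by (auto simp: unbounded_in_def)
  have \<psi>_cof: "\<exists>a\<in>A. \<beta> < \<psi> a" if \<beta>: "\<beta> < \<gamma>" for \<beta>
  proof -
    obtain \<eta> where "\<beta> < \<eta>" "\<eta> < \<gamma>" using \<gamma>(2) \<beta> unfolding limit_point_def by blast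
    moreover then obtain b where "b \<in> B" "\<eta> \<le> b" using B(1) by (auto simp: unbounded_in_def)
    ultimately show ?thesis using \<psi> by (metis image_iff less_le_trans)
  qed
  define X where "X \<delta> = {f (\<psi> a) \<delta> |a. a \<in> A \<and> a < \<delta>}" for \<delta>
  define h where "h \<delta> = (LEAST s. \<forall>x\<in>X \<delta>. x \<le> s)" for \<delta>
  have X_bound: "\<forall>x\<in>X \<delta>. x \<le> succ_card \<delta>" if "\<delta> \<in> S" for \<delta>
    using f_bound[OF less_trans[OF \<psi>_less \<gamma>(1)] that] unfolding X_def by (auto intro: less_imp_le)
  have "eventually (\<lambda>\<delta>. f \<beta> \<delta> < h \<delta>) F" if \<beta>: "\<beta> < \<gamma>" for \<beta>
  proof -
    obtain a where a: "a \<in> A" "\<beta> < \<psi> a" using \<psi>_cof[OF \<beta>] by blast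
    have "\<psi> a < \<nu>" "a < \<kappa>" using \<psi>_less[OF a(1)] \<gamma>(1) unbounded_A a(1) by (auto simp: unbounded_in_def)
    from eventually_S f_increasing[OF a(2) this(1)] eventually_gt[OF this(2)]
    show ?thesis
    proof eventually_elim
      case (elim \<delta>)
      then have "f (\<psi> a) \<delta> \<in> X \<delta>" using a(1) by (auto simp: X_def)
      then have "f (\<psi> a) \<delta> \<le> h \<delta>" unfolding h_def by (rule Sup_least(1)[OF X_bound[OF elim(1)]])
      then show ?case using elim(2) by simp
    qed
  qed
  moreover have "\<exists>\<beta><\<gamma>. frequently (\<lambda>\<delta>. g \<delta> < f \<beta> \<delta>) F" if g: "frequently (\<lambda>\<delta>. g \<delta> < h \<delta>) F" for g
  proof -
    have "eventually (\<lambda>\<delta>. g \<delta> < h \<delta> \<longrightarrow> (\<exists>a\<in>A. a < \<delta> \<and> g \<delta> < f (\<psi> a) \<delta>)) F"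
      using eventually_S
    proof eventually_elim
      case (elim \<delta>)
      show ?case using Sup_least(2)[OF X_bound[OF elim], of "g \<delta>"] unfolding h_def[symmetric] by (auto simp: X_def)
    qed
    then have "frequently (\<lambda>\<delta>. \<exists>a\<in>A. a < \<delta> \<and> g \<delta> < f (\<psi> a) \<delta>) F"
      by (rule frequently_rev_mp[OF g])
    then show ?thesis using pressing_down[of "\<lambda>a \<delta>. g \<delta> < f (\<psi> a) \<delta>"] \<psi>_less by blast
  qed
  ultimately show ?thesis using False unfolding is_lub_def by blast
qed

definition lub :: "'a \<Rightarrow> 'a \<Rightarrow> 'a" where
  "lub \<gamma> = (SOME h. is_lub \<gamma> h)"

lemma is_lub_lub: "\<gamma> < \<nu> \<Longrightarrow> limit_point \<gamma> UNIV \<Longrightarrow> is_lub \<gamma> (lub \<gamma>)"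
  unfolding lub_def using ex_lub by (rule someI_ex)

lemma less_lub: "\<gamma> < \<nu> \<Longrightarrow> limit_point \<gamma> UNIV \<Longrightarrow> \<beta> < \<gamma> \<Longrightarrow> eventually (\<lambda>\<delta>. f \<beta> \<delta> < lub \<gamma> \<delta>) F"
  using is_lub_lub unfolding is_lub_def by blast

lemma lub_least:
  "\<gamma> < \<nu> \<Longrightarrow> limit_point \<gamma> UNIV \<Longrightarrow> frequently (\<lambda>\<delta>. g \<delta> < lub \<gamma> \<delta>) F \<Longrightarrow>
    \<exists>\<beta><\<gamma>. frequently (\<lambda>\<delta>. g \<delta> < f \<beta> \<delta>) F"
  using is_lub_lub unfolding is_lub_def by blast

text \<open>Modulo F, the function \<open>f \<gamma>\<close> bounds its predecessors, so leastness
  applies.\<close>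

lemma lub_le: "\<gamma> < \<nu> \<Longrightarrow> limit_point \<gamma> UNIV \<Longrightarrow> eventually (\<lambda>\<delta>. lub \<gamma> \<delta> \<le> f \<gamma> \<delta>) F"
proof (rule ccontr)
  assume \<gamma>: "\<gamma> < \<nu>" "limit_point \<gamma> UNIV"
  assume "\<not> eventually (\<lambda>\<delta>. lub \<gamma> \<delta> \<le> f \<gamma> \<delta>) F"
  then have "frequently (\<lambda>\<delta>. f \<gamma> \<delta> < lub \<gamma> \<delta>) F" by (simp add: frequently_def not_less)
  then obtain \<beta> where \<beta>: "\<beta> < \<gamma>" "frequently (\<lambda>\<delta>. f \<gamma> \<delta> < f \<beta> \<delta>) F" using lub_least[OF \<gamma>] by blast
  have "eventually (\<lambda>\<delta>. \<not> f \<gamma> \<delta> < f \<beta> \<delta>) F"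
    using f_increasing[OF \<beta>(1) \<gamma>(1)] by eventually_elim simp
  then show False using \<beta>(2) by (simp add: frequently_def)
qed

lemma lub_less:
  assumes "\<beta> < \<gamma>" "\<gamma> < \<nu>" "limit_point \<beta> UNIV" "limit_point \<gamma> UNIV"
  shows "eventually (\<lambda>\<delta>. lub \<beta> \<delta> < lub \<gamma> \<delta>) F"
proof -
  have "\<beta> < \<nu>" using assms by simp
  from lub_le[OF this assms(3)] less_lub[OF assms(2,4,1)]
  show ?thesis by eventually_elim simp
qed

definition large :: "'a set" where
  "large = {\<alpha>. \<alpha> < \<nu> \<and> lam < cof \<alpha>}"

lemma large_limit: "\<alpha> \<in> large \<Longrightarrow> limit_point \<alpha> UNIV"
  using limit_point_if_less_cof[OF inf_lam] by (auto simp: large_def)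

lemma lub_exact:
  "\<alpha> \<in> large \<Longrightarrow> \<exists>\<beta><\<alpha>. eventually (\<lambda>\<delta>. g \<delta> < lub \<alpha> \<delta> \<longrightarrow> g \<delta> < f \<beta> \<delta>) F"
  using is_lub_lub[of \<alpha>] large_limit[of \<alpha>] unfolding is_lub_def large_def by blast

lemma lub_cof: "\<alpha> \<in> large \<Longrightarrow> eventually (\<lambda>\<delta>. lam < cof (lub \<alpha> \<delta>)) F"
  using is_lub_lub[of \<alpha>] large_limit[of \<alpha>] unfolding is_lub_def large_def by blast

text \<open>Makes the square sequence at \<delta> applicable to \<open>lub \<alpha> \<delta>\<close>
  almost everywhere.\<close>

lemma lub_lim_below:
  assumes "\<alpha> \<in> large"
  shows "eventually (\<lambda>\<delta>. lub \<alpha> \<delta> \<in> lim_below (succ_card \<delta>)) F"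
proof -
  have \<alpha>: "\<alpha> < \<nu>" "limit_point \<alpha> UNIV" using assms large_limit by (auto simp: large_def)
  from lub_cof[OF assms] lub_le[OF \<alpha>] eventually_S
  show ?thesis
  proof eventually_elim
    case (elim \<delta>)
    then show ?case
      using f_bound[OF \<alpha>(1), of \<delta>] limit_point_if_less_cof[OF inf_lam, of "lub \<alpha> \<delta>"]
      by (auto simp: lim_below_def)
  qed
qed

section \<open>The partial square sequence\<close>

text \<open>Defined for every \<alpha>, not only in \<open>large\<close>, because coherence refers
  to \<open>E \<gamma>\<close> at limit points \<gamma> of any cofinality.\<close>

definition E :: "'a \<Rightarrow> 'a set" where
  "E \<alpha> = {\<gamma>. \<gamma> < \<alpha> \<and> limit_point \<gamma> UNIV \<and>
     eventually (\<lambda>\<delta>. limit_point (lub \<gamma> \<delta>) (Cs \<delta> (lub \<alpha> \<delta>))) F}"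

lemma E_limit: "\<gamma> \<in> E \<alpha> \<Longrightarrow> limit_point \<gamma> UNIV"
  and E_less: "\<gamma> \<in> E \<alpha> \<Longrightarrow> \<gamma> < \<alpha>"
  by (auto simp: E_def)

text \<open>If the ladder failed to accumulate at \<open>lub \<gamma> \<delta>\<close> on a
  stationary set, let g bound there the part of the ladder below
  \<open>lub \<gamma> \<delta>\<close>. Leastness puts g below some \<open>f \<beta>\<close> on a
  stationary set, and the ladder point c above \<open>f \<beta>\<close> contradicts the choice of
  g.\<close>

lemma E_memI:
  assumes \<gamma>: "\<gamma> < \<alpha>" "\<alpha> < \<nu>" "limit_point \<gamma> UNIV"
    and inter: "\<And>\<beta>. \<beta> < \<gamma> \<Longrightarrow>
      \<exists>c. eventually (\<lambda>\<delta>. c \<delta> \<in> Cs \<delta> (lub \<alpha> \<delta>) \<and> f \<beta> \<delta> < c \<delta> \<and> c \<delta> < lub \<gamma> \<delta>) F"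
  shows "\<gamma> \<in> E \<alpha>"
proof (rule ccontr)
  have \<gamma>\<nu>: "\<gamma> < \<nu>" using \<gamma> by simp
  let ?lim = "\<lambda>\<delta>. limit_point (lub \<gamma> \<delta>) (Cs \<delta> (lub \<alpha> \<delta>))"
  define Q where "Q \<delta> \<xi> \<longleftrightarrow> \<xi> < lub \<gamma> \<delta> \<and> (\<forall>\<eta>\<in>Cs \<delta> (lub \<alpha> \<delta>). \<not> (\<xi> < \<eta> \<and> \<eta> < lub \<gamma> \<delta>))" for \<delta> \<xi>
  \<comment> \<open>Where the ladder does accumulate, the default
    \<open>lub \<gamma> \<delta>\<close> keeps g from lying below any \<open>f \<beta>\<close> that
    is below the lub.\<close>
  define g where "g \<delta> = (if ?lim \<delta> then lub \<gamma> \<delta> else SOME \<xi>. Q \<delta> \<xi>)" for \<delta>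
  assume "\<gamma> \<notin> E \<alpha>"
  then have freq: "frequently (\<lambda>\<delta>. \<not> ?lim \<delta>) F" using \<gamma> by (auto simp: E_def frequently_def)
  \<comment> \<open>Any \<beta>0 below \<gamma> serves: it makes
    \<open>lub \<gamma> \<delta>\<close> nonzero almost everywhere, so failure of
    \<open>limit_point\<close> must come from a gap in the ladder.\<close>
  obtain \<beta>0 where \<beta>0: "\<beta>0 < \<gamma>" using \<gamma>(3) by (auto simp: limit_point_def)
  have gQ: "Q \<delta> (g \<delta>)" if "\<not> ?lim \<delta>" "f \<beta>0 \<delta> < lub \<gamma> \<delta>" for \<delta>
  proof -
    have "\<exists>\<xi>. Q \<delta> \<xi>" using that unfolding Q_def limit_point_def by blast
    then show ?thesis using that(1) unfolding g_def by (simp add: someI_ex)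
  qed
  have "eventually (\<lambda>\<delta>. \<not> ?lim \<delta> \<longrightarrow> g \<delta> < lub \<gamma> \<delta>) F"
    using less_lub[OF \<gamma>\<nu> \<gamma>(3) \<beta>0] by eventually_elim (use gQ Q_def in blast)
  then have "frequently (\<lambda>\<delta>. g \<delta> < lub \<gamma> \<delta>) F" by (rule frequently_rev_mp[OF freq])
  then obtain \<beta> where \<beta>: "\<beta> < \<gamma>" "frequently (\<lambda>\<delta>. g \<delta> < f \<beta> \<delta>) F" using lub_least[OF \<gamma>\<nu> \<gamma>(3)] by blast
  obtain c where c: "eventually (\<lambda>\<delta>. c \<delta> \<in> Cs \<delta> (lub \<alpha> \<delta>) \<and> f \<beta> \<delta> < c \<delta> \<and> c \<delta> < lub \<gamma> \<delta>) F"
    using inter[OF \<beta>(1)] by blast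
  have "eventually (\<lambda>\<delta>. \<not> g \<delta> < f \<beta> \<delta>) F"
    using c less_lub[OF \<gamma>\<nu> \<gamma>(3) \<beta>0]
  proof eventually_elim
    case (elim \<delta>)
    show ?case
    proof (cases "?lim \<delta>")
      case True
      then show ?thesis using elim by (auto simp: g_def)
    next
      case False
      then show ?thesis using gQ[OF False elim(2)] elim(1) unfolding Q_def by (meson less_trans)
    qed
  qed
  then show False using \<beta>(2) by (simp add: frequently_def)
qed

text \<open>For \<xi> in \<open>E \<alpha>\<close> below \<gamma>, the function
  \<open>lub \<xi>\<close> itself is the interpolating ladder point, since ladders are
  closed.\<close>

lemma E_closed:
  assumes \<alpha>: "\<alpha> \<in> large" and \<gamma>: "\<gamma> < \<alpha>" "limit_point \<gamma> (E \<alpha>)"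
  shows "\<gamma> \<in> E \<alpha>"
proof -
  have lims: "\<alpha> < \<nu>" "limit_point \<gamma> UNIV" "\<gamma> < \<nu>" using \<alpha> \<gamma> by (auto simp: large_def limit_point_def)
  show ?thesis
  proof (rule E_memI[OF \<gamma>(1) lims(1,2)])
    fix \<beta> assume "\<beta> < \<gamma>"
    then obtain \<xi> where \<xi>: "\<xi> \<in> E \<alpha>" "\<beta> < \<xi>" "\<xi> < \<gamma>" using \<gamma>(2) by (auto simp: limit_point_def)
    have "\<xi> < \<nu>" using \<xi> lims by simp
    from \<xi>(1) have "eventually (\<lambda>\<delta>. limit_point (lub \<xi> \<delta>) (Cs \<delta> (lub \<alpha> \<delta>))) F" by (simp add: E_def)
    then have "eventually (\<lambda>\<delta>. lub \<xi> \<delta> \<in> Cs \<delta> (lub \<alpha> \<delta>) \<and> f \<beta> \<delta> < lub \<xi> \<delta> \<and> lub \<xi> \<delta> < lub \<gamma> \<delta>) F"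
      using less_lub[OF \<open>\<xi> < \<nu>\<close> E_limit[OF \<xi>(1)] \<xi>(2)] lub_less[OF \<xi>(3) lims(3) E_limit[OF \<xi>(1)] lims(2)]
        lub_less[OF E_less[OF \<xi>(1)] lims(1) E_limit[OF \<xi>(1)] large_limit[OF \<alpha>]]
        lub_lim_below[OF \<alpha>] eventually_S
      by eventually_elim (use square in \<open>auto simp: club_in_def\<close>)
    then show "\<exists>c. eventually (\<lambda>\<delta>. c \<delta> \<in> Cs \<delta> (lub \<alpha> \<delta>) \<and> f \<beta> \<delta> < c \<delta> \<and> c \<delta> < lub \<gamma> \<delta>) F" by blast
  qed
qed

text \<open>Pick a ladder point above \<open>f \<beta>\<close> at each \<delta>. The resulting
  function is below \<open>lub \<alpha>\<close>, so by exactness a single later f dominates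
  it.\<close>

lemma E_step:
  assumes \<alpha>: "\<alpha> \<in> large" and \<beta>: "\<beta> < \<alpha>"
  shows "\<exists>\<beta>' c. \<beta>' < \<alpha> \<and> \<beta> < \<beta>' \<and>
    eventually (\<lambda>\<delta>. c \<delta> \<in> Cs \<delta> (lub \<alpha> \<delta>) \<and> f \<beta> \<delta> < c \<delta> \<and> c \<delta> < f \<beta>' \<delta>) F"
proof -
  have \<alpha>\<nu>: "\<alpha> < \<nu>" using \<alpha> by (simp add: large_def)
  define c where "c \<delta> = (SOME c. c \<in> Cs \<delta> (lub \<alpha> \<delta>) \<and> f \<beta> \<delta> < c)" for \<delta>
  have c: "eventually (\<lambda>\<delta>. c \<delta> \<in> Cs \<delta> (lub \<alpha> \<delta>) \<and> f \<beta> \<delta> < c \<delta> \<and> c \<delta> < lub \<alpha> \<delta>) F"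
    using less_lub[OF \<alpha>\<nu> large_limit[OF \<alpha>] \<beta>] lub_lim_below[OF \<alpha>] eventually_S
  proof eventually_elim
    case (elim \<delta>)
    then have u: "unbounded_in (Cs \<delta> (lub \<alpha> \<delta>)) (lub \<alpha> \<delta>)" using square by (auto simp: club_in_def)
    have "limit_point (lub \<alpha> \<delta>) UNIV" using elim by (simp add: lim_below_def)
    then obtain \<eta> where "f \<beta> \<delta> < \<eta>" "\<eta> < lub \<alpha> \<delta>" using elim by (auto simp: limit_point_def)
    then have "\<exists>c. c \<in> Cs \<delta> (lub \<alpha> \<delta>) \<and> f \<beta> \<delta> < c" using u unfolding unbounded_in_def by (meson less_le_trans)
    then have "c \<delta> \<in> Cs \<delta> (lub \<alpha> \<delta>) \<and> f \<beta> \<delta> < c \<delta>" unfolding c_def by (rule someI_ex)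
    then show ?case using u by (auto simp: unbounded_in_def)
  qed
  obtain \<beta>1 where \<beta>1: "\<beta>1 < \<alpha>" "eventually (\<lambda>\<delta>. c \<delta> < lub \<alpha> \<delta> \<longrightarrow> c \<delta> < f \<beta>1 \<delta>) F"
    using lub_exact[OF \<alpha>] by blast
  have "max \<beta> \<beta>1 < \<alpha>" using \<beta> \<beta>1 by simp
  then obtain \<beta>' where \<beta>': "max \<beta> \<beta>1 < \<beta>'" "\<beta>' < \<alpha>" using large_limit[OF \<alpha>] unfolding limit_point_def by blast
  have "\<beta>1 < \<beta>'" "\<beta>' < \<nu>" using \<beta>' \<alpha>\<nu> by auto
  from f_increasing[OF this] c \<beta>1(2)
  have "eventually (\<lambda>\<delta>. c \<delta> \<in> Cs \<delta> (lub \<alpha> \<delta>) \<and> f \<beta> \<delta> < c \<delta> \<and> c \<delta> < f \<beta>' \<delta>) F"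
    by eventually_elim auto
  then show ?thesis using \<beta>' by auto
qed

text \<open>Iterating \<open>E_step\<close> from \<xi> interleaves ladder points with an
  \<omega>-sequence of functions f. The supremum of the indices stays below \<alpha> because its
  cofinality is uncountable, and the interleaving puts it into \<open>E \<alpha>\<close>.\<close>

lemma E_unbounded:
  assumes \<alpha>: "\<alpha> \<in> large"
  shows "unbounded_in (E \<alpha>) \<alpha>"
proof -
  have \<alpha>\<nu>: "\<alpha> < \<nu>" "lam < cof \<alpha>" using \<alpha> by (auto simp: large_def)
  have "\<exists>\<gamma>\<in>E \<alpha>. \<xi> \<le> \<gamma>" if \<xi>: "\<xi> < \<alpha>" for \<xi>
  proof -
    let ?R = "\<lambda>\<beta> \<beta>'. \<beta> < \<beta>' \<and>
      (\<exists>c. eventually (\<lambda>\<delta>. c \<delta> \<in> Cs \<delta> (lub \<alpha> \<delta>) \<and> f \<beta> \<delta> < c \<delta> \<and> c \<delta> < f \<beta>' \<delta>) F)"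
    have "\<exists>u. \<forall>n. (u n < \<alpha> \<and> (n = 0 \<longrightarrow> u n = \<xi>)) \<and> ?R (u n) (u (Suc n))"
      by (rule dependent_nat_choice) (use \<xi> E_step[OF \<alpha>] in blast)+
    then obtain u where u: "\<And>n::nat. u n < \<alpha>" "u 0 = \<xi>" "\<And>n. ?R (u n) (u (Suc n))" by blast
    have "|range u| \<le>o |{..<lam}|"
      using inf_lam card_of_image[of u UNIV] ordLeq_transitive unfolding infinite_iff_card_of_nat by blast
    then obtain y where y: "y < \<alpha>" "\<forall>n. u n < y"
      using not_unbounded_less_cof[OF \<alpha>\<nu>(2), of "range u"] u(1) by auto
    define \<gamma> where "\<gamma> = (LEAST y. \<forall>n. u n < y)"
    have \<gamma>: "\<forall>n. u n < \<gamma>" unfolding \<gamma>_def by (rule LeastI[of "\<lambda>y. \<forall>n. u n < y"]) (rule y(2))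
    have "\<gamma> \<le> y" unfolding \<gamma>_def by (rule Least_le) (rule y(2))
    then have \<gamma>\<alpha>: "\<gamma> < \<alpha>" using y by simp
    have below: "\<exists>n. \<beta> \<le> u n" if "\<beta> < \<gamma>" for \<beta>
      using not_less_Least[of \<beta> "\<lambda>y. \<forall>n. u n < y"] that unfolding \<gamma>_def by (meson leI)
    have lim: "limit_point \<gamma> UNIV"
      unfolding limit_point_def 
    proof (intro conjI allI impI)
      show "{..<\<gamma>} \<noteq> {}" using \<gamma> by blast
      fix \<beta> assume "\<beta> < \<gamma>"
      then obtain n where "\<beta> \<le> u n" using below by blast
      then have "\<beta> < u (Suc n)" using u(3)[of n] by (meson le_less_trans)
      then show "\<exists>\<eta>\<in>UNIV. \<beta> < \<eta> \<and> \<eta> < \<gamma>" using \<gamma> by blast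
    qed
    have \<gamma>\<nu>: "\<gamma> < \<nu>" using \<gamma>\<alpha> \<alpha>\<nu> by simp
    have "\<gamma> \<in> E \<alpha>"
    proof (rule E_memI[OF \<gamma>\<alpha> \<alpha>\<nu>(1) lim])
      fix \<beta> assume "\<beta> < \<gamma>"
      then obtain n where n: "\<beta> \<le> u n" using below by blast
      have "\<beta> < u (Suc n)" "u (Suc n) < \<nu>" using n u(1,3) \<alpha>\<nu>(1) by (meson le_less_trans less_trans)+
      then have le: "eventually (\<lambda>\<delta>. f \<beta> \<delta> < f (u (Suc n)) \<delta>) F" by (rule f_increasing)
      \<comment> \<open>The next interleaved ladder point after index \<open>Suc n\<close> lies
        above \<open>f \<beta>\<close> and still below \<open>lub \<gamma>\<close>.\<close>
      obtain c where "eventually (\<lambda>\<delta>. c \<delta> \<in> Cs \<delta> (lub \<alpha> \<delta>) \<and> f (u (Suc n)) \<delta> < c \<delta> \<and> c \<delta> < f (u (Suc (Suc n))) \<delta>) F"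
        using u(3) by blast
      with le less_lub[OF \<gamma>\<nu> lim \<gamma>[rule_format, of "Suc (Suc n)"]]
      have "eventually (\<lambda>\<delta>. c \<delta> \<in> Cs \<delta> (lub \<alpha> \<delta>) \<and> f \<beta> \<delta> < c \<delta> \<and> c \<delta> < lub \<gamma> \<delta>) F"
        by eventually_elim (meson less_trans)
      then show "\<exists>c. eventually (\<lambda>\<delta>. c \<delta> \<in> Cs \<delta> (lub \<alpha> \<delta>) \<and> f \<beta> \<delta> < c \<delta> \<and> c \<delta> < lub \<gamma> \<delta>) F" by blast
    qed
    moreover have "\<xi> \<le> \<gamma>" using \<gamma> u(2) by (metis less_imp_le)
    ultimately show ?thesis by blast
  qed
  then show ?thesis unfolding unbounded_in_def using E_less by blast
qed

lemma club_E: "\<alpha> \<in> large \<Longrightarrow> club_in (E \<alpha>) \<alpha>"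
  unfolding club_in_def using E_unbounded E_closed by blast

lemma limit_point_inter: "x \<le> y \<Longrightarrow> limit_point x (C \<inter> {..<y}) \<longleftrightarrow> limit_point x C"
  unfolding limit_point_def by (auto dest: less_le_trans) (metis IntI less_le_trans lessThan_iff)

text \<open>By closure \<gamma> is in \<open>E \<alpha>\<close>, so almost everywhere
  \<open>lub \<gamma> \<delta>\<close> is a limit point of the ladder, and square coherence
  identifies the cut ladder with the one at \<open>lub \<gamma> \<delta>\<close>. The two ladders
  have the same limit points below it.\<close>

lemma E_coherent:
  assumes \<alpha>: "\<alpha> \<in> large" and lim: "limit_point \<gamma> (E \<alpha>)"
  shows "E \<alpha> \<inter> {..<\<gamma>} = E \<gamma>"
proof -
  have \<alpha>\<nu>: "\<alpha> < \<nu>" using \<alpha> by (simp add: large_def)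
  consider "\<gamma> < \<alpha>" | "\<gamma> = \<alpha>" | "\<alpha> < \<gamma>" by fastforce
  then show ?thesis
  proof cases
    case 1
    then have \<gamma>: "\<gamma> \<in> E \<alpha>" using E_closed[OF \<alpha>] lim by blast
    have Ceq: "eventually (\<lambda>\<delta>. Cs \<delta> (lub \<alpha> \<delta>) \<inter> {..<lub \<gamma> \<delta>} = Cs \<delta> (lub \<gamma> \<delta>)) F"
    proof -
      have "eventually (\<lambda>\<delta>. limit_point (lub \<gamma> \<delta>) (Cs \<delta> (lub \<alpha> \<delta>))) F" using \<gamma> by (simp add: E_def)
      with lub_less[OF 1 \<alpha>\<nu> E_limit[OF \<gamma>] large_limit[OF \<alpha>]] lub_lim_below[OF \<alpha>] eventually_S
      show ?thesis by eventually_elim (use square in blast)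
    qed
    have "eventually (\<lambda>\<delta>. limit_point (lub \<xi> \<delta>) (Cs \<delta> (lub \<alpha> \<delta>))) F \<longleftrightarrow>
        eventually (\<lambda>\<delta>. limit_point (lub \<xi> \<delta>) (Cs \<delta> (lub \<gamma> \<delta>))) F"
      if "\<xi> < \<gamma>" "limit_point \<xi> UNIV" for \<xi>
    proof (rule eventually_subst)
      have "\<gamma> < \<nu>" using 1 \<alpha>\<nu> by simp
      from lub_less[OF that(1) this that(2) E_limit[OF \<gamma>]] Ceq
      show "eventually (\<lambda>\<delta>. limit_point (lub \<xi> \<delta>) (Cs \<delta> (lub \<alpha> \<delta>)) =
        limit_point (lub \<xi> \<delta>) (Cs \<delta> (lub \<gamma> \<delta>))) F"
        by eventually_elim (metis less_imp_le limit_point_inter)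
    qed
    then show ?thesis using 1 unfolding E_def by auto
  next
    case 2
    then show ?thesis using E_less by blast
  next
    case 3
    then obtain \<eta> where "\<eta> \<in> E \<alpha>" "\<alpha> < \<eta>" using lim by (auto simp: limit_point_def)
    then show ?thesis using E_less[of \<eta> \<alpha>] by auto
  qed
qed

section \<open>The size of the sets \<open>E \<alpha>\<close>\<close>

lemma ladder_card:
  assumes \<alpha>: "\<alpha> \<in> large"
  shows "\<exists>a\<in>A. frequently (\<lambda>\<delta>. |Cs \<delta> (lub \<alpha> \<delta>)| \<le>o |{..<a}| ) F"
proof (rule pressing_down)
  have "eventually (\<lambda>\<delta>. \<exists>a\<in>A. a < \<delta> \<and> |Cs \<delta> (lub \<alpha> \<delta>)| \<le>o |{..<a}| ) F"
    using lub_cof[OF \<alpha>] lub_lim_below[OF \<alpha>] eventually_S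
  proof eventually_elim
    case (elim \<delta>)
    define C where "C = Cs \<delta> (lub \<alpha> \<delta>)"
    have C: "unbounded_in C (lub \<alpha> \<delta>)" "otp C \<le> \<delta>" using square elim by (auto simp: C_def club_in_def)
    obtain \<phi> where \<phi>: "bij_betw \<phi> C {..<otp C}" "strict_mono_on C \<phi>"
      using otp_iso[of C "lub \<alpha> \<delta>"] C(1) by (auto simp: unbounded_in_def)
    \<comment> \<open>If the ladder had full length \<delta>, its elements with index in A would be
      cofinal in it, because \<delta> is a limit point of A. There are at most \<open>lam\<close> of
      them, too few for the cofinality of \<open>lub \<alpha> \<delta>\<close>.\<close>
    have "otp C \<noteq> \<delta>"
    proof
      assume o: "otp C = \<delta>"
      define B where "B = {c\<in>C. \<phi> c \<in> A}"
      have "inj_on \<phi> B" "\<phi> ` B \<subseteq> A" using \<phi>(1) by (auto simp: B_def bij_betw_def inj_on_def)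
      then have "|B| \<le>o |A|" using card_of_ordLeq by blast
      then have "|B| \<le>o |{..<lam}|" using card_A ordLeq_ordIso_trans by blast
      moreover have "unbounded_in B (lub \<alpha> \<delta>)"
        unfolding unbounded_in_def
      proof (intro conjI allI impI)
        show "B \<subseteq> {..<lub \<alpha> \<delta>}" using C(1) by (auto simp: B_def unbounded_in_def)
        fix \<xi> assume "\<xi> < lub \<alpha> \<delta>"
        then obtain c where c: "c \<in> C" "\<xi> \<le> c" using C(1) by (auto simp: unbounded_in_def)
        have "\<phi> c < \<delta>" using \<phi>(1) c(1) o by (auto simp: bij_betw_def)
        then obtain a where a: "a \<in> A" "\<phi> c < a" "a < \<delta>" using S_limit[OF elim(3)] by (auto simp: limit_point_def)
        have "a \<in> \<phi> ` C" using a(3) \<phi>(1) o by (auto simp: bij_betw_def)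
        then obtain c' where c': "c' \<in> C" "a = \<phi> c'" by blast
        then have "c < c'" using strict_mono_on_less[OF \<phi>(2) c(1) c'(1)] a(2) by simp
        then show "\<exists>\<eta>\<in>B. \<xi> \<le> \<eta>" using c c' a(1) by (auto simp: B_def)
      qed
      ultimately show False using elim(1) unfolding less_cof_iff by blast
    qed
    with C(2) have "otp C < \<delta>" by simp
    \<comment> \<open>Rounding the length up to an element of A below \<delta> makes the bound
      regressive with values in A, as Fodor's lemma requires.\<close>
    then obtain a where a: "a \<in> A" "otp C < a" "a < \<delta>" using S_limit[OF elim(3)] by (auto simp: limit_point_def)
    have "|C| =o |{..<otp C}|" using \<phi>(1) card_of_ordIso by blast
    moreover have "|{..<otp C}| \<le>o |{..<a}|" using a(2) by (intro card_of_lessThan_mono) simp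
    ultimately have "|C| \<le>o |{..<a}|" by (rule ordIso_ordLeq_trans)
    with a show ?case unfolding C_def by blast
  qed
  then show "frequently (\<lambda>\<delta>. \<exists>a\<in>A. a < \<delta> \<and> |Cs \<delta> (lub \<alpha> \<delta>)| \<le>o |{..<a}| ) F"
    using F_neq_bot eventually_frequently by blast
qed

lemma E_card:
  assumes \<alpha>: "\<alpha> \<in> large"
  shows "|E \<alpha>| <o |{..<\<kappa>}|"
proof -
  have \<alpha>\<nu>: "\<alpha> < \<nu>" using \<alpha> by (simp add: large_def)
  obtain a where a: "a \<in> A" "frequently (\<lambda>\<delta>. |Cs \<delta> (lub \<alpha> \<delta>)| \<le>o |{..<a}| ) F"
    using ladder_card[OF \<alpha>] by blast
  define Z where "Z = {\<delta>\<in>S. |Cs \<delta> (lub \<alpha> \<delta>)| \<le>o |{..<a}| }"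
  have "\<forall>\<delta>\<in>Z. \<exists>e. inj_on e (Cs \<delta> (lub \<alpha> \<delta>)) \<and> e ` Cs \<delta> (lub \<alpha> \<delta>) \<subseteq> {..<a}"
    unfolding Z_def by (auto simp: card_of_ordLeq)
  then obtain e where e: "\<And>\<delta>. \<delta> \<in> Z \<Longrightarrow> inj_on (e \<delta>) (Cs \<delta> (lub \<alpha> \<delta>))"
    "\<And>\<delta>. \<delta> \<in> Z \<Longrightarrow> e \<delta> ` Cs \<delta> (lub \<alpha> \<delta>) \<subseteq> {..<a}" by metis
  \<comment> \<open>The code is the graph of a partial function on the stationary set Z, giving the
    position of \<open>lub \<gamma> \<delta>\<close> in the short ladder. Distinct lubs differ
    almost everywhere, hence at some point of Z where both are in the ladder.\<close>
  define code where "code \<gamma> = {(\<delta>, e \<delta> (lub \<gamma> \<delta>)) |\<delta>. \<delta> \<in> Z \<and> lub \<gamma> \<delta> \<in> Cs \<delta> (lub \<alpha> \<delta>)}" for \<gamma>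
  have mem: "eventually (\<lambda>\<delta>. lub \<gamma> \<delta> \<in> Cs \<delta> (lub \<alpha> \<delta>)) F" if \<gamma>: "\<gamma> \<in> E \<alpha>" for \<gamma>
  proof -
    have "eventually (\<lambda>\<delta>. limit_point (lub \<gamma> \<delta>) (Cs \<delta> (lub \<alpha> \<delta>))) F" using \<gamma> by (simp add: E_def)
    then show ?thesis
      using lub_less[OF E_less[OF \<gamma>] \<alpha>\<nu> E_limit[OF \<gamma>] large_limit[OF \<alpha>]] lub_lim_below[OF \<alpha>] eventually_S
      by eventually_elim (use square in \<open>auto simp: club_in_def\<close>)
  qed
  have neq: "code \<gamma> \<noteq> code \<gamma>'" if \<gamma>: "\<gamma> \<in> E \<alpha>" "\<gamma>' \<in> E \<alpha>" "\<gamma> < \<gamma>'" for \<gamma> \<gamma>'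
  proof -
    have "\<gamma>' < \<nu>" using E_less[OF \<gamma>(2)] \<alpha>\<nu> by simp
    from lub_less[OF \<gamma>(3) this E_limit[OF \<gamma>(1)] E_limit[OF \<gamma>(2)]] mem[OF \<gamma>(1)] mem[OF \<gamma>(2)] eventually_S
    have "eventually (\<lambda>\<delta>. |Cs \<delta> (lub \<alpha> \<delta>)| \<le>o |{..<a}| \<longrightarrow> \<delta> \<in> Z \<and> lub \<gamma> \<delta> < lub \<gamma>' \<delta> \<and>
      lub \<gamma> \<delta> \<in> Cs \<delta> (lub \<alpha> \<delta>) \<and> lub \<gamma>' \<delta> \<in> Cs \<delta> (lub \<alpha> \<delta>)) F"
      by eventually_elim (simp add: Z_def)
    then have "frequently (\<lambda>\<delta>. \<delta> \<in> Z \<and> lub \<gamma> \<delta> < lub \<gamma>' \<delta> \<and>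
      lub \<gamma> \<delta> \<in> Cs \<delta> (lub \<alpha> \<delta>) \<and> lub \<gamma>' \<delta> \<in> Cs \<delta> (lub \<alpha> \<delta>)) F"
      by (rule frequently_rev_mp[OF a(2)])
    then obtain \<delta> where \<delta>: "\<delta> \<in> Z" "lub \<gamma> \<delta> < lub \<gamma>' \<delta>"
      "lub \<gamma> \<delta> \<in> Cs \<delta> (lub \<alpha> \<delta>)" "lub \<gamma>' \<delta> \<in> Cs \<delta> (lub \<alpha> \<delta>)"
      using frequently_ex by blast
    then have "e \<delta> (lub \<gamma> \<delta>) \<noteq> e \<delta> (lub \<gamma>' \<delta>)" using inj_onD[OF e(1)] by fastforce
    then have "(\<delta>, e \<delta> (lub \<gamma> \<delta>)) \<in> code \<gamma>" "(\<delta>, e \<delta> (lub \<gamma> \<delta>)) \<notin> code \<gamma>'"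
      using \<delta> by (auto simp: code_def)
    then show ?thesis by blast
  qed
  have "inj_on code (E \<alpha>)"
    unfolding inj_on_def using neq by (metis linorder_neqE)
  moreover have "code ` E \<alpha> \<subseteq> Pow (S \<times> {..<a})" using e(2) by (auto simp: code_def Z_def)
  ultimately have 1: "|E \<alpha>| \<le>o |Pow (S \<times> {..<a})|" using card_of_ordLeq by blast
  \<comment> \<open>One ordinal below \<kappa> bounds both factors of the product, so the strong
    limit hypothesis controls its power set.\<close>
  let ?m = "max lam a"
  have "a < \<kappa>" using a(1) unbounded_A by (auto simp: unbounded_in_def)
  then have m: "?m < \<kappa>" using lam_less by simp
  have le: "|{..<lam}| \<le>o |{..<?m}|" "|{..<a}| \<le>o |{..<?m}|" by (intro card_of_lessThan_mono; simp)+
  then have "infinite {..<?m}" using inf_lam card_of_ordLeq_infinite by blast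
  then have "|S \<times> {..<a}| \<le>o |{..<?m}|"
    using card_of_Times_ordLeq_infinite_Field[OF _ _ _ card_of_Card_order, of "{..<?m}" S "{..<a}"]
      ordLeq_transitive[OF card_S le(1)] le(2) by (metis Field_card_of)
  then have "|Pow (S \<times> {..<a})| \<le>o |Pow {..<?m}|" by (rule card_of_Pow_ordLeq)
  with 1 strong_limit[OF m] show ?thesis using ordLeq_transitive ordLeq_ordLess_trans by blast
qed

end

section \<open>Exact upper bounds at good points\<close>

context uncountable_cofinality
begin

text \<open>Take the pointwise supremum along the set G witnessing goodness. A function below it
  needs one index from G for each \<delta>; as S has at most \<open>lam\<close> elements, these
  indices have a common bound in G, which gives exactness.\<close>

lemma good_point_lub:
  assumes good: "good_point \<kappa> S' f \<alpha>" and sub: "S \<subseteq> S'" and cof: "lam < cof \<alpha>"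
    and inf: "infinite {..<lam}" and card_S: "|S| \<le>o |{..<lam}|"
    and incr: "\<And>\<beta> \<gamma>. \<beta> < \<gamma> \<Longrightarrow> \<gamma> < \<alpha> \<Longrightarrow> eventually (\<lambda>\<delta>. f \<beta> \<delta> < f \<gamma> \<delta>) (club_filter \<kappa> S)"
    and bound: "\<And>\<beta> \<delta>. \<beta> < \<alpha> \<Longrightarrow> \<delta> \<in> S \<Longrightarrow> f \<beta> \<delta> < succ_card \<delta>"
  shows "\<exists>h. (\<forall>\<beta><\<alpha>. eventually (\<lambda>\<delta>. f \<beta> \<delta> < h \<delta>) (club_filter \<kappa> S))
       \<and> (\<forall>g. \<exists>\<beta><\<alpha>. eventually (\<lambda>\<delta>. g \<delta> < h \<delta> \<longrightarrow> g \<delta> < f \<beta> \<delta>) (club_filter \<kappa> S))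
       \<and> eventually (\<lambda>\<delta>. lam < cof (h \<delta>)) (club_filter \<kappa> S)"
proof -
  let ?F = "club_filter \<kappa> S"
  obtain G j where G: "unbounded_in G \<alpha>" and j: "j < \<kappa>"
    and mono: "\<And>\<delta>. \<delta> \<in> S' \<Longrightarrow> j \<le> \<delta> \<Longrightarrow> strict_mono_on G (\<lambda>\<beta>. f \<beta> \<delta>)"
    using good unfolding good_point_def by blast
  have lim: "limit_point \<alpha> UNIV" using inf cof by (rule limit_point_if_less_cof)
  have G_less: "a < \<alpha>" if "a \<in> G" for a using G that by (auto simp: unbounded_in_def)
  have G_cof: "\<exists>a\<in>G. \<beta> < a" if \<beta>: "\<beta> < \<alpha>" for \<beta>
  proof -
    obtain \<eta> where "\<beta> < \<eta>" "\<eta> < \<alpha>" using lim \<beta> unfolding limit_point_def by blast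
    then show ?thesis using G unfolding unbounded_in_def by (meson less_le_trans)
  qed
  define X where "X \<delta> = (\<lambda>a. f a \<delta>) ` G" for \<delta>
  define h where "h \<delta> = (LEAST s. \<forall>x\<in>X \<delta>. x \<le> s)" for \<delta>
  have X_bound: "\<forall>x\<in>X \<delta>. x \<le> succ_card \<delta>" if "\<delta> \<in> S" for \<delta>
    using bound[OF G_less that] by (auto simp: X_def intro: less_imp_le)
  have mono': "f a \<delta> < f b \<delta>" if "\<delta> \<in> S" "j < \<delta>" "a \<in> G" "b \<in> G" "a < b" for a b \<delta>
    using mono[of \<delta>] that sub by (auto simp: strict_mono_on_def)
  have upper: "f a \<delta> < h \<delta>" if \<delta>: "\<delta> \<in> S" "j < \<delta>" and a: "a \<in> G" for a \<delta>
  proof -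
    obtain b where b: "b \<in> G" "a < b" using G_cof[OF G_less[OF a]] by blast
    have "f b \<delta> \<le> h \<delta>" unfolding h_def using b by (intro Sup_least(1)[OF X_bound[OF \<delta>(1)]]) (auto simp: X_def)
    then show ?thesis using mono'[OF \<delta> a b] by simp
  qed
  have lower: "\<exists>a\<in>G. x < f a \<delta>" if "\<delta> \<in> S" "x < h \<delta>" for x \<delta>
    using Sup_least(2)[OF X_bound[OF that(1)], of x] that(2) by (auto simp: h_def X_def)
  \<comment> \<open>Used twice: with Z a set of points \<delta> for exactness, and with Z a small
    subset of \<open>h \<delta>\<close> for its cofinality.\<close>
  have collect: "\<exists>a\<in>G. \<forall>z\<in>Z. p z < a" if Z: "|Z| \<le>o |{..<lam}|" "\<forall>z\<in>Z. p z \<in> G" for Z :: "'a set" and p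
  proof -
    have "|p ` Z| \<le>o |{..<lam}|" using Z(1) card_of_image ordLeq_transitive by blast
    then obtain \<xi> where "\<xi> < \<alpha>" "\<forall>b\<in>p ` Z. b < \<xi>"
      using not_unbounded_less_cof[OF cof, of "p ` Z"] Z(2) G_less by blast
    moreover then obtain a where "a \<in> G" "\<xi> < a" using G_cof by blast
    ultimately show ?thesis by (metis image_eqI less_trans)
  qed
  have 1: "eventually (\<lambda>\<delta>. f \<beta> \<delta> < h \<delta>) ?F" if \<beta>: "\<beta> < \<alpha>" for \<beta>
  proof -
    obtain a where a: "a \<in> G" "\<beta> < a" using G_cof[OF \<beta>] by blast
    from incr[OF a(2) G_less[OF a(1)]] eventually_mem[of S] eventually_greater[OF j, of S]
    show ?thesis by eventually_elim (use upper a(1) in \<open>meson less_trans\<close>)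
  qed
  have 2: "\<exists>\<beta><\<alpha>. eventually (\<lambda>\<delta>. g \<delta> < h \<delta> \<longrightarrow> g \<delta> < f \<beta> \<delta>) ?F" for g
  proof -
    let ?Z = "{\<delta>\<in>S. j < \<delta> \<and> g \<delta> < h \<delta>}"
    have "\<forall>\<delta>\<in>?Z. \<exists>a. a \<in> G \<and> g \<delta> < f a \<delta>" using lower by blast
    then obtain p where p: "\<And>\<delta>. \<delta> \<in> ?Z \<Longrightarrow> p \<delta> \<in> G \<and> g \<delta> < f (p \<delta>) \<delta>" by metis
    have "|?Z| \<le>o |{..<lam}|" using card_S card_of_mono1[of ?Z S] ordLeq_transitive by blast
    then obtain a where a: "a \<in> G" "\<forall>\<delta>\<in>?Z. p \<delta> < a" using collect p by blast
    from eventually_mem[of S] eventually_greater[OF j, of S]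
    have "eventually (\<lambda>\<delta>. g \<delta> < h \<delta> \<longrightarrow> g \<delta> < f a \<delta>) ?F"
    proof eventually_elim
      case (elim \<delta>)
      show ?case
      proof
        assume "g \<delta> < h \<delta>"
        then have "\<delta> \<in> ?Z" using elim by blast
        then show "g \<delta> < f a \<delta>" using p[of \<delta>] a mono'[OF elim, of "p \<delta>" a] by (meson less_trans)
      qed
    qed
    then show ?thesis using G_less[OF a(1)] by blast
  qed
  from eventually_mem[of S] eventually_greater[OF j, of S]
  have 3: "eventually (\<lambda>\<delta>. lam < cof (h \<delta>)) ?F"
  proof eventually_elim
    case (elim \<delta>)
    show ?case
      unfolding less_cof_iff
    proof (intro allI impI notI)
      fix B assume B: "unbounded_in B (h \<delta>)" "|B| \<le>o |{..<lam}|"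
      have "\<forall>b\<in>B. \<exists>a. a \<in> G \<and> b < f a \<delta>" using B(1) lower[OF elim(1)] unfolding unbounded_in_def by blast
      then obtain p where p: "\<And>b. b \<in> B \<Longrightarrow> p b \<in> G \<and> b < f (p b) \<delta>" by metis
      then obtain a where a: "a \<in> G" "\<forall>b\<in>B. p b < a" using collect[OF B(2), of p] by blast
      obtain b where b: "b \<in> B" "f a \<delta> \<le> b" using B(1) upper[OF elim a(1)] by (auto simp: unbounded_in_def)
      have "f (p b) \<delta> < f a \<delta>" using mono'[OF elim, of "p b" a] p[OF b(1)] a b(1) by blast
      then show False using p[OF b(1)] b(2) by auto
    qed
  qed
  show ?thesis using 1 2 3 by blast
qed

end

text \<open>A proper initial segment of A embeds into an ordinal below the cofinality of \<kappa>,
  so no image of it is cofinal in \<kappa>.\<close>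

lemma uncountable_cofinality_if:
  fixes \<kappa> :: "'a::wellorder"
  assumes inf: "infinite {..<\<kappa>}" and unc: "first_infinite < cof \<kappa>"
    and A: "unbounded_in A \<kappa>" "otp A = cof \<kappa>"
  shows "uncountable_cofinality \<kappa> A"
proof
  show "unbounded_in A \<kappa>" by fact
  have fi: "infinite {..<first_infinite::'a}" unfolding first_infinite_def using inf by (rule LeastI)
  show "\<exists>y<\<kappa>. \<forall>n. u n < y" if "\<And>n::nat. u n < \<kappa>" for u
  proof -
    have "|range u| \<le>o |{..<first_infinite::'a}|"
      using fi card_of_image[of u UNIV] ordLeq_transitive unfolding infinite_iff_card_of_nat by blast
    then show ?thesis using not_unbounded_less_cof[OF unc, of "range u"] that by auto
  qed
  show "\<exists>y<\<kappa>. \<forall>a\<in>A. a < x \<longrightarrow> g a < y" if x: "x < \<kappa>" and g: "\<And>a. a \<in> A \<Longrightarrow> a < x \<Longrightarrow> g a < \<kappa>" for x g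
  proof -
    obtain \<phi> where \<phi>: "bij_betw \<phi> A {..<cof \<kappa>}" "strict_mono_on A \<phi>"
      using otp_iso[of A \<kappa>] A by (auto simp: unbounded_in_def)
    obtain a where a: "a \<in> A" "x \<le> a" using A(1) x by (auto simp: unbounded_in_def)
    let ?B = "{b\<in>A. b < x}"
    have "inj_on \<phi> ?B" using \<phi>(1) by (auto simp: bij_betw_def inj_on_def)
    moreover have "\<phi> ` ?B \<subseteq> {..<\<phi> a}" using strict_mono_onD[OF \<phi>(2)] a by force
    ultimately have "|?B| \<le>o |{..<\<phi> a}|" using card_of_ordLeq by blast
    then have "|g ` ?B| \<le>o |{..<\<phi> a}|" using card_of_image ordLeq_transitive by blast
    moreover have "\<phi> a < cof \<kappa>" using \<phi>(1) a(1) by (auto simp: bij_betw_def)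
    ultimately have "\<exists>\<xi><\<kappa>. \<forall>b\<in>g ` ?B. b < \<xi>" using g by (intro not_unbounded_less_cof) auto
    then show ?thesis by auto
  qed
qed

section \<open>Assembly of the partial square sequence\<close>

theorem theorem1p4:
  fixes \<kappa> lam :: "'a::wellorder" and S :: "'a set"
  assumes succ_exists: "\<exists>\<nu>>\<kappa>. is_cardinal \<nu>"
    and "singular_cardinal \<kappa>"
    and "strong_limit_cardinal \<kappa>"
    and "cof \<kappa> = lam"
    and "first_infinite < lam"
    and "stationary_in S \<kappa>"
    and "\<forall>\<delta>\<in>S. is_cardinal \<delta> \<and> square \<delta>"
    and "\<exists>f. good_scale \<kappa> S f"
  shows "\<exists>C. partial_square_seq \<kappa> {\<alpha>. \<alpha> < succ_card \<kappa> \<and> lam < cof \<alpha>} C"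
proof -
  define \<nu> where "\<nu> = succ_card \<kappa>"
  have \<kappa>: "is_cardinal \<kappa>" "infinite {..<\<kappa>}" "lam < \<kappa>"
    using assms(2,4) by (auto simp: singular_cardinal_def)
  have \<nu>: "\<kappa> < \<nu>" "is_cardinal \<nu>" using succ_card_exists[OF succ_exists] by (auto simp: \<nu>_def)
  have regular: "|B| \<le>o |{..<\<kappa>}| \<Longrightarrow> \<not> unbounded_in B \<nu>" for B
    unfolding \<nu>_def using succ_exists \<kappa>(2) by (rule bounded_in_succ_card)
  have initial: "b < \<nu> \<Longrightarrow> |{..<b}| \<le>o |{..<\<kappa>}|" for b
    unfolding \<nu>_def by (rule card_le_if_less_succ_card)
  have "infinite {..<first_infinite::'a}" unfolding first_infinite_def using \<kappa>(2) by (rule LeastI)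
  then have inf_lam: "infinite {..<lam}"
    using assms(5) finite_subset[of "{..<first_infinite}" "{..<lam}"] by (auto dest: less_imp_le)

  obtain A where A: "unbounded_in A \<kappa>" "otp A = cof \<kappa>" using cof_witness by blast
  interpret uncountable_cofinality \<kappa> A
    using \<kappa>(2) assms(4,5) A by (intro uncountable_cofinality_if) auto
  have card_A: "|A| =o |{..<lam}|"
    using otp_card_ordIso[of A \<kappa>] A assms(4) by (auto simp: unbounded_in_def)
  \<comment> \<open>Thinning to limit points of A keeps the set stationary and reduces its size to
    at most \<open>lam\<close>.\<close>
  define S' where "S' = {\<delta>\<in>S. limit_point \<delta> A}"
  define F where "F = club_filter \<kappa> S'"
  have S_below: "S \<subseteq> {..<\<kappa>}" using assms(6) by (simp add: stationary_in_def)
  have card_S': "|S'| \<le>o |{..<lam}|"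
    unfolding S'_def using card_limit_points[OF A(1) S_below] card_A by (rule ordLeq_ordIso_trans)

  obtain f D where f: "scale \<kappa> S f" and D: "club_in D \<nu>"
    and good: "\<And>\<alpha>. \<alpha> \<in> D \<Longrightarrow> lam < cof \<alpha> \<Longrightarrow> good_point \<kappa> S f \<alpha>"
    using assms(4,8) unfolding good_scale_def \<nu>_def by blast
  interpret D: club_enumeration \<kappa> \<nu> D
    using D initial regular by unfold_locales
  have f_bound: "f \<alpha> \<delta> < succ_card \<delta>" if "\<alpha> < \<nu>" "\<delta> \<in> S'" for \<alpha> \<delta>
    using f that unfolding scale_def succ_prod_def \<nu>_def S'_def by (auto simp: PiE_iff)
  have f_incr: "eventually (\<lambda>\<delta>. f \<beta> \<delta> < f \<alpha> \<delta>) F" if less: "\<beta> < \<alpha>" "\<alpha> < \<nu>" for \<alpha> \<beta>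
  proof -
    obtain j where j: "j < \<kappa>" "\<forall>\<delta>\<in>S. j \<le> \<delta> \<longrightarrow> f \<beta> \<delta> < f \<alpha> \<delta>"
      using f less unfolding scale_def ev_less_def \<nu>_def by blast
    from eventually_greater[OF j(1), of S'] eventually_mem[of S']
    show ?thesis unfolding F_def by eventually_elim (use j in \<open>auto simp: S'_def\<close>)
  qed
  \<comment> \<open>After reindexing, every \<alpha> of cofinality above \<open>lam\<close>
    corresponds to a point \<open>D.d \<alpha>\<close> of D, which is good.\<close>
  define f' where "f' \<alpha> = f (D.d \<alpha>)" for \<alpha>
  have "\<forall>\<delta>\<in>S. \<exists>C. \<forall>\<alpha>\<in>lim_below (succ_card \<delta>). club_in (C \<alpha>) \<alpha> \<and> otp (C \<alpha>) \<le> \<delta> \<and>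
     (\<forall>\<beta><\<alpha>. limit_point \<beta> (C \<alpha>) \<longrightarrow> C \<alpha> \<inter> {..<\<beta>} = C \<beta>)"
    using assms(7) unfolding square_def by blast
  then obtain Cs where Cs: "\<forall>\<delta>\<in>S. \<forall>\<alpha>\<in>lim_below (succ_card \<delta>). club_in (Cs \<delta> \<alpha>) \<alpha> \<and> otp (Cs \<delta> \<alpha>) \<le> \<delta> \<and>
     (\<forall>\<beta><\<alpha>. limit_point \<beta> (Cs \<delta> \<alpha>) \<longrightarrow> Cs \<delta> \<alpha> \<inter> {..<\<beta>} = Cs \<delta> \<beta>)"
    by (rule bchoice[THEN exE]) blast
  interpret good_sequence \<kappa> A S' lam \<nu> f' Cs F
  proof
    show "S' \<subseteq> {..<\<kappa>}" using S_below by (auto simp: S'_def)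
    show "limit_point \<delta> A" if "\<delta> \<in> S'" for \<delta> using that by (simp add: S'_def)
    show "F \<noteq> bot" unfolding F_def S'_def using assms(6) by (rule club_filter_neq_bot)
    show "eventually (\<lambda>\<delta>. f' \<beta> \<delta> < f' \<alpha> \<delta>) F" if "\<beta> < \<alpha>" "\<alpha> < \<nu>" for \<alpha> \<beta>
      unfolding f'_def using that by (intro f_incr D.d_mono D.d_less)
    show "f' \<alpha> \<delta> < succ_card \<delta>" if "\<alpha> < \<nu>" "\<delta> \<in> S'" for \<alpha> \<delta>
      unfolding f'_def using that by (intro f_bound D.d_less)
    show "|Pow {..<\<mu>}| <o |{..<\<kappa>}|" if "\<mu> < \<kappa>" for \<mu>
      using assms(3) that by (simp add: strong_limit_cardinal_def)
    show "club_in (Cs \<delta> \<alpha>) \<alpha> \<and> otp (Cs \<delta> \<alpha>) \<le> \<delta> \<and>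
       (\<forall>\<beta><\<alpha>. limit_point \<beta> (Cs \<delta> \<alpha>) \<longrightarrow> Cs \<delta> \<alpha> \<inter> {..<\<beta>} = Cs \<delta> \<beta>)"
      if "\<delta> \<in> S'" "\<alpha> \<in> lim_below (succ_card \<delta>)" for \<delta> \<alpha>
      using Cs that by (simp add: S'_def)
    show "\<exists>h. (\<forall>\<beta><\<alpha>. eventually (\<lambda>\<delta>. f' \<beta> \<delta> < h \<delta>) F)
       \<and> (\<forall>g. \<exists>\<beta><\<alpha>. eventually (\<lambda>\<delta>. g \<delta> < h \<delta> \<longrightarrow> g \<delta> < f' \<beta> \<delta>) F)
       \<and> eventually (\<lambda>\<delta>. lam < cof (h \<delta>)) F" if \<alpha>: "\<alpha> < \<nu>" "lam < cof \<alpha>" for \<alpha>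
    proof -
      have lim: "limit_point \<alpha> UNIV" using inf_lam \<alpha>(2) by (rule limit_point_if_less_cof)
      have cof: "lam < cof (D.d \<alpha>)" using D.less_cof_d[OF \<alpha>(1) lim \<alpha>(2)] .
      have d: "D.d \<alpha> < \<nu>" "D.d \<alpha> \<in> D" using \<alpha>(1) D.d_less D.d_mem by blast+
      have sub: "S' \<subseteq> S" by (auto simp: S'_def)
      have incr: "eventually (\<lambda>\<delta>. f \<beta> \<delta> < f \<gamma> \<delta>) F" if "\<beta> < \<gamma>" "\<gamma> < D.d \<alpha>" for \<beta> \<gamma>
        using that d(1) by (intro f_incr) auto
      have bound: "f \<beta> \<delta> < succ_card \<delta>" if "\<beta> < D.d \<alpha>" "\<delta> \<in> S'" for \<beta> \<delta>
        using that d(1) by (intro f_bound) auto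
      obtain h where h: "\<forall>\<beta><D.d \<alpha>. eventually (\<lambda>\<delta>. f \<beta> \<delta> < h \<delta>) F"
        "\<And>g. \<exists>\<beta><D.d \<alpha>. eventually (\<lambda>\<delta>. g \<delta> < h \<delta> \<longrightarrow> g \<delta> < f \<beta> \<delta>) F"
        "eventually (\<lambda>\<delta>. lam < cof (h \<delta>)) F"
        using good_point_lub[OF good[OF d(2) cof] sub cof inf_lam card_S', folded F_def, OF incr bound]
        by blast
      \<comment> \<open>Exactness transfers from \<open>D.d \<alpha>\<close> to \<alpha> because, by
        continuity, the values \<open>D.d \<gamma>\<close> for \<gamma> below \<alpha> are cofinal
        in \<open>D.d \<alpha>\<close>.\<close>
      have "\<exists>\<beta><\<alpha>. eventually (\<lambda>\<delta>. g \<delta> < h \<delta> \<longrightarrow> g \<delta> < f' \<beta> \<delta>) F" for g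
      proof -
        obtain \<beta> where \<beta>: "\<beta> < D.d \<alpha>" "eventually (\<lambda>\<delta>. g \<delta> < h \<delta> \<longrightarrow> g \<delta> < f \<beta> \<delta>) F" using h(2) by blast
        obtain \<gamma> where \<gamma>: "\<gamma> < \<alpha>" "\<beta> \<le> D.d \<gamma>" using D.d_continuous[OF \<alpha>(1) lim \<beta>(1)] by blast
        have "D.d \<gamma> < \<nu>" using \<gamma>(1) \<alpha>(1) by (intro D.d_less) simp
        then have "eventually (\<lambda>\<delta>. f \<beta> \<delta> \<le> f (D.d \<gamma>) \<delta>) F"
          using \<gamma>(2) eventually_mono[OF f_incr[of \<beta> "D.d \<gamma>"]] by (cases "\<beta> = D.d \<gamma>") auto
        with \<beta>(2) have "eventually (\<lambda>\<delta>. g \<delta> < h \<delta> \<longrightarrow> g \<delta> < f' \<gamma> \<delta>) F"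
          unfolding f'_def by eventually_elim auto
        then show ?thesis using \<gamma>(1) by blast
      qed
      moreover have "eventually (\<lambda>\<delta>. f' \<beta> \<delta> < h \<delta>) F" if "\<beta> < \<alpha>" for \<beta>
        unfolding f'_def using h(1) D.d_mono[OF that \<alpha>(1)] by blast
      ultimately show ?thesis using h(3) by blast
    qed
  qed (fact card_S' card_A inf_lam \<kappa>(3) F_def)+

  have "stationary_in large \<nu>"
    unfolding stationary_in_def
  proof (intro conjI allI impI)
    show "large \<subseteq> {..<\<nu>}" by (auto simp: large_def)
    fix C assume "club_in C \<nu>"
    then interpret C: club_enumeration \<kappa> \<nu> C using initial regular by unfold_locales
    have lam: "\<exists>\<mu>>lam. is_cardinal \<mu>" using \<kappa> by blast
    \<comment> \<open>The successor of \<open>lam\<close> is regular and at most \<kappa>, so the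
      element of C with this index has cofinality above \<open>lam\<close>.\<close>
    define \<mu> where "\<mu> = succ_card lam"
    have "\<mu> \<le> \<kappa>" unfolding \<mu>_def using succ_card_exists(3)[OF lam \<kappa>(3,1)] .
    then have \<mu>: "\<mu> < \<nu>" using \<nu>(1) by simp
    have cof: "lam < cof \<mu>"
      unfolding less_cof_iff \<mu>_def using bounded_in_succ_card[OF lam inf_lam] by blast
    then have "lam < cof (C.d \<mu>)"
      using C.less_cof_d[OF \<mu> limit_point_if_less_cof[OF inf_lam cof]] by blast
    then have "C.d \<mu> \<in> large \<inter> C" using C.d_mem[OF \<mu>] C.d_less[OF \<mu>] by (auto simp: large_def)
    then show "large \<inter> C \<noteq> {}" by blast
  qed
  moreover have "large \<subseteq> lim_below \<nu>" using large_limit by (auto simp: lim_below_def large_def)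
  moreover have "otp (E \<alpha>) \<le> \<kappa>" if \<alpha>: "\<alpha> \<in> large" for \<alpha>
  proof (rule leI, rule notI)
    assume "\<kappa> < otp (E \<alpha>)"
    then have "|{..<\<kappa>}| \<le>o |{..<otp (E \<alpha>)}|" by (intro card_of_lessThan_mono) simp
    also have "|{..<otp (E \<alpha>)}| =o |E \<alpha>|"
      using otp_card_ordIso[of "E \<alpha>" \<alpha>] E_less ordIso_symmetric by blast
    finally show False using E_card[OF \<alpha>] not_ordLess_ordLeq by blast
  qed
  \<comment> \<open>At a common limit point \<gamma>, both cut sets equal
    \<open>E \<gamma>\<close>.\<close>
  ultimately have "partial_square_seq \<kappa> large E"
    unfolding partial_square_seq_def \<nu>_def[symmetric] using \<kappa>(1) club_E E_coherent by simp
  then show ?thesis unfolding large_def unfolding \<nu>_def by blast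
qed

end
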